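(* Let $N\ge1$, $k=(k_1,k_2)$, let $\mathbf f\in\bar{\mathbf S}_{k,\simeq}(N)$ be a nonzero simultaneous eigenvector of all $T_{n_1,n_2}$ ($n_1,n_2$ positive, coprime to $N$), and let $H=\{\epsilon\in(\mathbb Z/N\mathbb Z)^\times:\mathbf f_{-\epsilon}\neq0\}$. Then: (1) $H$ is a subgroup of $(\mathbb Z/N\mathbb Z)^\times$; (2) $H$ depends only on $\mathbf f_{-1}$, i.e. any other such eigenvector $\mathbf g$ with $\mathbf g_{-1}=\mathbf f_{-1}$ yields the same $H$; (3) every element of $(\mathbb Z/N\mathbb Z)^\times/H$ has order one or two; (4) if $\mathbf g\in\bar{\mathbf S}_{k,\simeq}(N)$ is another such eigenvector, then $\mathbf g_{-1}=\mathbf f_{-1}$ if and only if there is a character $\chi$ of $H$ with $\mathbf g_{-\epsilon}=\chi(\epsilon)\mathbf f_{-\epsilon}$ for all $\epsilon\in H$.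
   Context: For $\epsilon\in(\mathbb Z/N\mathbb Z)^\times$, $\Gamma_{\simeq,\epsilon}(N)$ is the group of pairs $\left(\begin{pmatrix}a_1&b_1\\c_1&d_1\end{pmatrix},\begin{pmatrix}a_2&b_2\\c_2&d_2\end{pmatrix}\right)\in\mathrm{SL}_2(\mathbb Z)^2$ with $a_1\equiv a_2$, $b_1\equiv\epsilon b_2$, $\epsilon c_1\equiv c_2$, $d_1\equiv d_2\pmod N$; $S_k(\Gamma)$ denotes weight-$k$ holomorphic cusp forms on $\mathfrak H^2$, with Fourier coefficients $c_{m_1,m_2}$ in $q_i=e^{2\pi iz_i/N}$. $\bar S_k(\Gamma_{\simeq,\epsilon}(N))$ is the quotient of $S_k(\Gamma_{\simeq,\epsilon}(N))$ by forms with $c_{m_1,m_2}=0$ whenever $m_1,m_2$ are coprime to $N$, and $\bar{\mathbf S}_{k,\simeq}(N)=\prod_\epsilon\bar S_k(\Gamma_{\simeq,\epsilon}(N))$ with components $\mathbf f_\epsilon$. With slash $(f|_{k,\gamma})(z_1,z_2)=f(\gamma_1z_1,\gamma_2z_2)j(\gamma_1,z_1)^{-k_1}j(\gamma_2,z_2)^{-k_2}$, $j(\sigma,z)=(\det\sigma)^{-1/2}(cz+d)$, and $\sigma_a\in\mathrm{SL}_2(\mathbb Z)$ congruent to $\mathrm{diag}(a^{-1},a)$ mod $N$, for positive $n_1,n_2$ coprime to $N$ the Hecke operator $T_{n_1,n_2}f=n_1^{k_1/2-1}n_2^{k_2/2-1}\sum f|_{k,(\sigma_{a_1}\begin{pmatrix}a_1&b_1N\\0&d_1\end{pmatrix},\sigma_{a_2}\begin{pmatrix}a_2&b_2N\\0&d_2\end{pmatrix})}$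 (sum over $a_i,d_i>0$, $a_id_i=n_i$, $0\le b_i<d_i$) maps forms on $\Gamma_{\simeq,\epsilon}(N)$ to forms on $\Gamma_{\simeq,\epsilon n_1/n_2}(N)$ and descends to the quotients; on $\bar{\mathbf S}_{k,\simeq}(N)$ it acts by $(T_{n_1,n_2}\mathbf f)_\epsilon=T_{n_1,n_2}(\mathbf f_{\epsilon n_2/n_1})$. *)

theory Defs
  imports
    "HOL-Analysis.Analysis"
    "HOL-Algebra.Multiplicative_Group"
    "HOL-Number_Theory.Cong"
begin

section \<open>The group of units modulo \<open>N\<close>\<close>

text \<open>
  Residue classes are represented by their representatives in \<open>{0..<N}\<close>.  The unit element is
  \<open>1 mod N\<close>, so that \<open>N = 1\<close> gives the trivial group with carrier \<open>{0}\<close>; the units of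
  \<open>residue_ring N\<close> would not do in this case, since the constant \<open>one\<close> there is always \<open>1\<close>.
\<close>

definition units_mod :: "nat \<Rightarrow> int monoid" where
  "units_mod N =
     \<lparr>carrier = {e. 0 \<le> e \<and> e < int N \<and> coprime e (int N)},
      monoid.mult = (\<lambda>x y. (x * y) mod int N),
      one = 1 mod int N\<rparr>"

lemma comm_group_units_mod:
  assumes "N \<ge> 1"
  shows "comm_group (units_mod N)"
proof (rule comm_groupI)
  fix x assume x: "x \<in> carrier (units_mod N)"
  then have "coprime x (int N)"
    by (simp add: units_mod_def)
  then obtain y where y: "[x * y = 1] (mod int N)"
    using cong_solve_coprime_int by blast
  then have "coprime y (int N)"
    by (metis cong_imp_coprime cong_sym coprime_1_left coprime_mult_left_iff)
  moreover have "(y mod int N * x) mod int N = 1 mod int N"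
    using y unfolding cong_def by (metis mod_mult_left_eq mult.commute)
  ultimately show "\<exists>y\<in>carrier (units_mod N). y \<otimes>\<^bsub>units_mod N\<^esub> x = \<one>\<^bsub>units_mod N\<^esub>"
    using assms by (intro bexI[of _ "y mod int N"]) (auto simp: units_mod_def)
qed (use assms in \<open>auto simp: units_mod_def mod_simps ac_simps\<close>)

definition neg_mod :: "nat \<Rightarrow> int \<Rightarrow> int" where
  "neg_mod N e = (- e) mod int N"

definition complex_units :: "complex monoid" where
  "complex_units = \<lparr>carrier = UNIV - {0}, monoid.mult = (*), one = 1\<rparr>"


section \<open>Pairs of integral matrices acting on \<open>\<HH>\<^sup>2\<close>\<close>

type_synonym imat = "int ^ 2 ^ 2"
type_synonym fun2 = "complex \<times> complex \<Rightarrow> complex"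

definition mat2 :: "int \<Rightarrow> int \<Rightarrow> int \<Rightarrow> int \<Rightarrow> imat" where
  "mat2 a b c d = vector [vector [a, b], vector [c, d]]"

definition SL2Z :: "imat set" where
  "SL2Z = {A. det A = 1}"

definition Gamma_sim :: "nat \<Rightarrow> int \<Rightarrow> (imat \<times> imat) set" where
  "Gamma_sim N e = {(A, B). A \<in> SL2Z \<and> B \<in> SL2Z \<and>
     [A $ 1 $ 1 = B $ 1 $ 1] (mod int N) \<and>
     [A $ 1 $ 2 = e * B $ 1 $ 2] (mod int N) \<and>
     [e * A $ 2 $ 1 = B $ 2 $ 1] (mod int N) \<and>
     [A $ 2 $ 2 = B $ 2 $ 2] (mod int N)}"

definition upper_half :: "complex set" where
  "upper_half = {z. Im z > 0}"

definition moeb :: "imat \<Rightarrow> complex \<Rightarrow> complex" where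
  "moeb A z = (of_int (A $ 1 $ 1) * z + of_int (A $ 1 $ 2)) /
              (of_int (A $ 2 $ 1) * z + of_int (A $ 2 $ 2))"

definition aut_factor :: "imat \<Rightarrow> complex \<Rightarrow> complex" where
  "aut_factor A z = of_real (real_of_int (det A) powr (- 1 / 2)) *
              (of_int (A $ 2 $ 1) * z + of_int (A $ 2 $ 2))"

definition slash ::
  "int \<times> int \<Rightarrow> imat \<times> imat \<Rightarrow> fun2 \<Rightarrow> fun2"
  where
  "slash k \<gamma> f z =
     f (moeb (fst \<gamma>) (fst z), moeb (snd \<gamma>) (snd z)) *
     aut_factor (fst \<gamma>) (fst z) powi (- fst k) *
     aut_factor (snd \<gamma>) (snd z) powi (- snd k)"


section \<open>Cusp forms\<close>

text \<open>Complex differentiability in two variables: the total derivative exists and is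
  complex-linear.\<close>

definition holomorphic2_on :: "fun2 \<Rightarrow> (complex \<times> complex) set \<Rightarrow> bool" where
  "holomorphic2_on f U \<longleftrightarrow>
     (\<forall>z\<in>U. \<exists>a b. (f has_derivative (\<lambda>h. a * fst h + b * snd h)) (at z))"

definition qpar :: "nat \<Rightarrow> complex \<Rightarrow> complex" where
  "qpar N z = exp (2 * of_real pi * \<i> * z / of_nat N)"

definition has_q_expansion ::
  "nat \<Rightarrow> fun2 \<Rightarrow> (nat \<Rightarrow> nat \<Rightarrow> complex) \<Rightarrow> bool" where
  "has_q_expansion N f c \<longleftrightarrow>
     (\<forall>z1\<in>upper_half. \<forall>z2\<in>upper_half.
        ((\<lambda>(m1, m2). c m1 m2 * qpar N z1 ^ m1 * qpar N z2 ^ m2) has_sum f (z1, z2)) UNIV)"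

definition fourier_coeff :: "nat \<Rightarrow> fun2 \<Rightarrow> nat \<Rightarrow> nat \<Rightarrow> complex" where
  "fourier_coeff N f = (THE c. has_q_expansion N f c)"

text \<open>
  \<open>cusp_forms N k \<Gamma>\<close> is intended for groups \<open>\<Gamma>\<close> of level \<open>N\<close>, i.e. containing
  \<open>\<Gamma>(N) \<times> \<Gamma>(N)\<close>, so that the expansion at every cusp is in powers of \<open>exp (2\<pi>iz\<^sub>j/N)\<close>.
  A cusp form vanishes along the whole boundary: at each cusp only the terms with both exponents
  positive occur.  Functions on \<open>\<HH>\<^sup>2\<close> are extended by \<open>0\<close>; matrices of positive determinant
  preserve \<open>\<HH>\<close> and its complement, so \<open>slash\<close> respects this convention.
\<close>

definition cusp_forms ::
  "nat \<Rightarrow> int \<times> int \<Rightarrow> (imat \<times> imat) set \<Rightarrow> fun2 set" where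
  "cusp_forms N k \<Gamma> = {f.
     (\<forall>z. z \<notin> upper_half \<times> upper_half \<longrightarrow> f z = 0) \<and>
     holomorphic2_on f (upper_half \<times> upper_half) \<and>
     (\<forall>\<gamma>\<in>\<Gamma>. \<forall>z\<in>upper_half \<times> upper_half. slash k \<gamma> f z = f z) \<and>
     (\<forall>\<gamma>\<in>SL2Z \<times> SL2Z. \<exists>c. has_q_expansion N (slash k \<gamma> f) c \<and>
        (\<forall>m1 m2. m1 = 0 \<or> m2 = 0 \<longrightarrow> c m1 m2 = 0))}"


section \<open>The quotient of the space of cusp forms\<close>

definition null_forms :: "nat \<Rightarrow> int \<times> int \<Rightarrow> int \<Rightarrow> fun2 set" where
  "null_forms N k e = {f \<in> cusp_forms N k (Gamma_sim N e).
     \<forall>m1 m2. coprime m1 N \<and> coprime m2 N \<longrightarrow> fourier_coeff N f m1 m2 = 0}"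

definition null_rel ::
  "nat \<Rightarrow> int \<times> int \<Rightarrow> int \<Rightarrow> (fun2 \<times> fun2) set"
  where
  "null_rel N k e = {(f, g).
     f \<in> cusp_forms N k (Gamma_sim N e) \<and> g \<in> cusp_forms N k (Gamma_sim N e) \<and>
     (\<lambda>z. f z - g z) \<in> null_forms N k e}"

definition Sbar :: "nat \<Rightarrow> int \<times> int \<Rightarrow> int \<Rightarrow> fun2 set set" where
  "Sbar N k e = cusp_forms N k (Gamma_sim N e) // null_rel N k e"

definition Sbar_class ::
  "nat \<Rightarrow> int \<times> int \<Rightarrow> int \<Rightarrow> fun2 \<Rightarrow> fun2 set"
  where
  "Sbar_class N k e f = null_rel N k e `` {f}"

definition Sbar_zero :: "nat \<Rightarrow> int \<times> int \<Rightarrow> int \<Rightarrow> fun2 set" where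
  "Sbar_zero N k e = Sbar_class N k e (\<lambda>_. 0)"

text \<open>Operations on the quotient are induced from representatives; for a well-defined operation
  all members of the union coincide.\<close>

definition Sbar_scale ::
  "nat \<Rightarrow> int \<times> int \<Rightarrow> int \<Rightarrow> complex \<Rightarrow>
   fun2 set \<Rightarrow> fun2 set" where
  "Sbar_scale N k e c X = (\<Union>f\<in>X. Sbar_class N k e (\<lambda>z. c * f z))"


section \<open>Hecke operators\<close>

text \<open>Any two choices of \<open>\<sigma>\<^sub>a\<close> differ by an element of \<open>\<Gamma>(N)\<close>, under which the forms
  considered here are invariant (in each variable separately).\<close>

definition sigma_mat :: "nat \<Rightarrow> nat \<Rightarrow> imat" where
  "sigma_mat N a = (SOME s. s \<in> SL2Z \<and>
     [s $ 1 $ 1 * int a = 1] (mod int N) \<and> [s $ 1 $ 2 = 0] (mod int N) \<and>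
     [s $ 2 $ 1 = 0] (mod int N) \<and> [s $ 2 $ 2 = int a] (mod int N))"

definition hecke_reps :: "nat \<Rightarrow> (nat \<times> nat \<times> nat) set" where
  "hecke_reps n = {(a, b, d). a > 0 \<and> d > 0 \<and> a * d = n \<and> b < d}"

definition hecke_mat :: "nat \<Rightarrow> nat \<times> nat \<times> nat \<Rightarrow> imat" where
  "hecke_mat N = (\<lambda>(a, b, d). sigma_mat N a ** mat2 (int a) (int b * int N) 0 (int d))"

definition hecke ::
  "nat \<Rightarrow> int \<times> int \<Rightarrow> nat \<Rightarrow> nat \<Rightarrow> fun2 \<Rightarrow> fun2"
  where
  "hecke N k n1 n2 f z =
     of_real (real n1 powr (real_of_int (fst k) / 2 - 1) *
              real n2 powr (real_of_int (snd k) / 2 - 1)) *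
     (\<Sum>(r1, r2) \<in> hecke_reps n1 \<times> hecke_reps n2.
        slash k (hecke_mat N r1, hecke_mat N r2) f z)"

definition Sbar_hecke ::
  "nat \<Rightarrow> int \<times> int \<Rightarrow> int \<Rightarrow> nat \<Rightarrow> nat \<Rightarrow>
   fun2 set \<Rightarrow> fun2 set" where
  \<comment> \<open>\<open>e\<close> is the index of the target space\<close>
  "Sbar_hecke N k e n1 n2 X = (\<Union>f\<in>X. Sbar_class N k e (hecke N k n1 n2 f))"


section \<open>The product over all \<open>\<epsilon>\<close>\<close>

definition SS :: "nat \<Rightarrow> int \<times> int \<Rightarrow> (int \<Rightarrow> fun2 set) set" where
  "SS N k = (\<Pi>\<^sub>E e\<in>carrier (units_mod N). Sbar N k e)"

definition SS_zero :: "nat \<Rightarrow> int \<times> int \<Rightarrow> int \<Rightarrow> fun2 set" where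
  "SS_zero N k = (\<lambda>e\<in>carrier (units_mod N). Sbar_zero N k e)"

definition SS_scale ::
  "nat \<Rightarrow> int \<times> int \<Rightarrow> complex \<Rightarrow>
   (int \<Rightarrow> fun2 set) \<Rightarrow> int \<Rightarrow> fun2 set" where
  "SS_scale N k c F = (\<lambda>e\<in>carrier (units_mod N). Sbar_scale N k e c (F e))"

definition SS_hecke ::
  "nat \<Rightarrow> int \<times> int \<Rightarrow> nat \<Rightarrow> nat \<Rightarrow>
   (int \<Rightarrow> fun2 set) \<Rightarrow> int \<Rightarrow> fun2 set" where
  "SS_hecke N k n1 n2 F = (\<lambda>e\<in>carrier (units_mod N).
     Sbar_hecke N k e n1 n2
       (F (e \<otimes>\<^bsub>units_mod N\<^esub> (int n2 mod int N) \<otimes>\<^bsub>units_mod N\<^esub>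
           inv\<^bsub>units_mod N\<^esub> (int n1 mod int N))))"

definition hecke_eigenvector ::
  "nat \<Rightarrow> int \<times> int \<Rightarrow> (int \<Rightarrow> fun2 set) \<Rightarrow> bool" where
  "hecke_eigenvector N k F \<longleftrightarrow> F \<in> SS N k \<and> F \<noteq> SS_zero N k \<and>
     (\<forall>n1 n2. n1 > 0 \<and> n2 > 0 \<and> coprime n1 N \<and> coprime n2 N \<longrightarrow>
        (\<exists>c. SS_hecke N k n1 n2 F = SS_scale N k c F))"

definition Hset ::
  "nat \<Rightarrow> int \<times> int \<Rightarrow> (int \<Rightarrow> fun2 set) \<Rightarrow> int set" where
  "Hset N k F = {e \<in> carrier (units_mod N). F (neg_mod N e) \<noteq> Sbar_zero N k (neg_mod N e)}"

end

theory Submission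
  imports Defs
begin

text \<open>
  Write \<open>c(m, n)\<close> for the Fourier coefficients and \<open>T(m, n)\<close> for the Hecke operators.  Invariance
  under translations shows that \<open>c(m, n) \<noteq> 0\<close> for a form on \<open>\<Gamma>\<^sub>\<epsilon>\<close> only if \<open>N\<close> divides \<open>\<epsilon>m + n\<close>,
  and the coefficient of \<open>T(m, n) f\<close> at \<open>(1, 1)\<close> is \<open>c(m, n)\<close>.  Hence a nonzero component at
  \<open>-\<epsilon>\<close> of an eigenvector yields \<open>m, n\<close> coprime to \<open>N\<close> with \<open>n/m = \<epsilon>\<close> and nonzero eigenvalue, and
  the eigenvector equation for this \<open>T(m, n)\<close> shows that multiplication by \<open>\<epsilon>\<close> preserves \<open>H\<close>.
  For two eigenvectors with the same component at \<open>-1\<close> the quotient of the eigenvalues is the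
  character.

  For squares it suffices to treat \<open>p\<^sup>2\<close> with \<open>p\<close> prime.  If \<open>p\<^sup>2 \<notin> H\<close>, then \<open>T(p, 1)\<close> and
  \<open>T(p\<^sup>2, 1)\<close> kill the component \<open>f\<close> at \<open>-1\<close>; comparing coefficients, \<open>f\<close> slashed with \<open>(\<sigma>\<^sub>p, 1)\<close>
  has no nonzero \<open>c(m, n)\<close> with \<open>m\<close> coprime to \<open>pN\<close> and \<open>n\<close> coprime to \<open>N\<close>.  Extracting a residue
  class of \<open>m\<close> modulo \<open>pN\<close> is a weighted average over shifts by \<open>b/p\<close>, and \<open>\<sigma>\<^sub>p\<close>, chosen with
  lower left entry \<open>p\<^sup>2N\<close>, permutes these shifts up to \<open>\<Gamma>(N)\<close>.  So the coefficient of \<open>f\<close> at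
  \<open>(1, 1)\<close> vanishes, a contradiction.
\<close>

subsection \<open>The slash operation\<close>

lemma det_imat: "det (A :: imat) = A $ 1 $ 1 * A $ 2 $ 2 - A $ 1 $ 2 * A $ 2 $ 1"
  by (simp add: det_2)

lemma imat_mult_nth: "((A :: imat) ** B) $ i $ j = A $ i $ 1 * B $ 1 $ j + A $ i $ 2 * B $ 2 $ j"
  by (simp add: matrix_matrix_mult_def UNIV_2)

lemma mat2_nth [simp]:
  "mat2 a b c d $ 1 $ 1 = a" "mat2 a b c d $ 1 $ 2 = b"
  "mat2 a b c d $ 2 $ 1 = c" "mat2 a b c d $ 2 $ 2 = d"
  by (simp_all add: mat2_def)

lemma det_mat2 [simp]: "det (mat2 a b c d) = a * d - b * c"
  by (simp add: det_imat)

lemma imat_eqI: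
  assumes "A $ 1 $ 1 = B $ 1 $ 1" "A $ 1 $ 2 = B $ 1 $ 2" "A $ 2 $ 1 = B $ 2 $ 1"
    "A $ 2 $ 2 = B $ 2 $ 2"
  shows "A = (B :: imat)"
  using assms by (simp add: vec_eq_iff forall_2)

lemma denom_nonzero:
  fixes A :: imat
  assumes "det A > 0" "z \<in> upper_half"
  shows "of_int (A $ 2 $ 1) * z + of_int (A $ 2 $ 2) \<noteq> (0 :: complex)"
proof
  assume *: "of_int (A $ 2 $ 1) * z + of_int (A $ 2 $ 2) = (0 :: complex)"
  have "Im (of_int (A $ 2 $ 1) * z + of_int (A $ 2 $ 2)) = of_int (A $ 2 $ 1) * Im z"
    by simp
  then have "A $ 2 $ 1 = 0"
    using * assms(2) by (simp add: upper_half_def)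
  with * assms(1) show False by (simp add: det_imat)
qed

lemma Im_moeb:
  assumes "det A > 0" "z \<in> upper_half"
  shows "Im (moeb A z) =
    of_int (det A) * Im z / (norm (of_int (A $ 2 $ 1) * z + of_int (A $ 2 $ 2) :: complex))\<^sup>2"
proof -
  obtain x y where z: "z = Complex x y" by (cases z)
  have "Im (moeb A z) = (of_int (A $ 1 $ 1) * y * (of_int (A $ 2 $ 1) * x + of_int (A $ 2 $ 2)) -
      (of_int (A $ 1 $ 1) * x + of_int (A $ 1 $ 2)) * (of_int (A $ 2 $ 1) * y)) /
      (norm (of_int (A $ 2 $ 1) * z + of_int (A $ 2 $ 2) :: complex))\<^sup>2"
    by (simp add: moeb_def z Im_divide cmod_def)
  also have "of_int (A $ 1 $ 1) * y * (of_int (A $ 2 $ 1) * x + of_int (A $ 2 $ 2)) -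
      (of_int (A $ 1 $ 1) * x + of_int (A $ 1 $ 2)) * (of_int (A $ 2 $ 1) * y) = of_int (det A) *
          Im z"
    by (simp add: det_imat z algebra_simps)
  finally show ?thesis .
qed

lemma moeb_upper_half:
  assumes "det A > 0" "z \<in> upper_half"
  shows "moeb A z \<in> upper_half"
  using Im_moeb[OF assms] denom_nonzero[OF assms] assms by (simp add: upper_half_def)

lemma moeb_times_denom:
  assumes "det B > 0" "z \<in> upper_half"
  shows "moeb B z * (of_int (B $ 2 $ 1) * z + of_int (B $ 2 $ 2)) =
    of_int (B $ 1 $ 1) * z + of_int (B $ 1 $ 2)"
  using denom_nonzero[OF assms] by (simp add: moeb_def)

text \<open>Multiplying \<open>moeb B z\<close> by its denominator clears the fraction. The row
  \<open>i = 1\<close> gives the numerator and \<open>i = 2\<close> the denominator of the composed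
  map, so \<open>moeb_mult\<close> and \<open>aut_factor_mult\<close> both follow.\<close>

lemma affine_moeb_mult:
  fixes A B :: imat
  assumes "det B > 0" "z \<in> upper_half"
  shows "of_int ((A ** B) $ i $ 1) * z + of_int ((A ** B) $ i $ 2) =
    (of_int (A $ i $ 1) * moeb B z + of_int (A $ i $ 2)) *
    (of_int (B $ 2 $ 1) * z + of_int (B $ 2 $ 2))"
proof -
  have "(of_int (A $ i $ 1) * moeb B z + of_int (A $ i $ 2)) *
      (of_int (B $ 2 $ 1) * z + of_int (B $ 2 $ 2)) =
    of_int (A $ i $ 1) * (moeb B z * (of_int (B $ 2 $ 1) * z + of_int (B $ 2 $ 2))) +
    of_int (A $ i $ 2) * (of_int (B $ 2 $ 1) * z + of_int (B $ 2 $ 2))"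
    by (simp only: ring_distribs mult.assoc add_ac)
  also have "\<dots> = of_int ((A ** B) $ i $ 1) * z + of_int ((A ** B) $ i $ 2)"
    by (simp only: moeb_times_denom[OF assms] imat_mult_nth of_int_add of_int_mult)
      (simp only: ring_distribs mult.assoc ac_simps)
  finally show ?thesis ..
qed

lemma moeb_mult:
  assumes "det A > 0" "det B > 0" "z \<in> upper_half"
  shows "moeb (A ** B) z = moeb A (moeb B z)"
  using denom_nonzero[OF assms(2,3)]
  unfolding moeb_def[of "A ** B"] moeb_def[of A] by (simp add: affine_moeb_mult assms)

lemma aut_factor_mult:
  assumes "det A > 0" "det B > 0" "z \<in> upper_half"
  shows "aut_factor (A ** B) z = aut_factor A (moeb B z) * aut_factor B z"
  using assms by (simp add: aut_factor_def affine_moeb_mult det_mul powr_mult)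

lemma slash_mult:
  assumes "det A1 > 0" "det A2 > 0" "det B1 > 0" "det B2 > 0"
    and "z1 \<in> upper_half" "z2 \<in> upper_half"
  shows "slash k (A1 ** B1, A2 ** B2) f (z1, z2) = slash k (B1, B2) (slash k (A1, A2) f) (z1, z2)"
  using assms by (simp add: slash_def moeb_mult aut_factor_mult power_int_mult_distrib)

lemma moeb_upper_triangular: "moeb (mat2 a b 0 d) z = (of_int a * z + of_int b) / of_int d"
  by (simp add: moeb_def)

lemma aut_factor_upper_triangular:
  "aut_factor (mat2 a b 0 d) z = of_real (real_of_int (a * d) powr (- 1 / 2)) * of_int d"
  by (simp add: aut_factor_def)

lemma mat1_eq_mat2: "mat 1 = mat2 1 0 0 1"
  by (rule imat_eqI) (simp_all add: mat_def)

lemma slash_one [simp]: "slash k (mat 1, mat 1) f = f"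
  by (rule ext) (simp add: slash_def mat1_eq_mat2 moeb_upper_triangular aut_factor_upper_triangular)

lemma slash_translation:
  "slash k (mat2 1 b1 0 1, mat2 1 b2 0 1) f (z1, z2) = f (z1 + of_int b1, z2 + of_int b2)"
  by (simp add: slash_def moeb_upper_triangular aut_factor_upper_triangular)

lemma slash_cong_upper_half:
  assumes "\<And>z. z \<in> upper_half \<times> upper_half \<Longrightarrow> f z = g z"
    and "det A1 > 0" "det A2 > 0" "z1 \<in> upper_half" "z2 \<in> upper_half"
  shows "slash k (A1, A2) f (z1, z2) = slash k (A1, A2) g (z1, z2)"
  using assms by (simp add: slash_def moeb_upper_half)


subsection \<open>Uniqueness of \<open>q\<close>-expansions\<close>

text \<open>By strong induction the lower coefficients vanish, so the series divided by
  \<open>x ^ n\<close> still sums to 0 off the origin; its limit at 0 is \<open>a n\<close>. The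
  origin is left out because \<open>qpar\<close> never takes the value 0.\<close>

lemma powser_punctured_zero:
  fixes a :: "nat \<Rightarrow> complex"
  assumes "\<And>x. x \<noteq> 0 \<Longrightarrow> norm x < 1 \<Longrightarrow> (\<lambda>n. a n * x ^ n) sums 0"
  shows "a n = 0"
proof (induction n rule: less_induct)
  case (less n)
  have "(\<lambda>m. a (m + n) * x ^ m) sums 0" if x: "x \<noteq> 0" "norm x < 1" for x
  proof -
    have "(\<lambda>m. a (m + n) * x ^ (m + n)) sums (0 - (\<Sum>i<n. a i * x ^ i))"
      by (rule sums_split_initial_segment) (rule assms[OF x])
    then have "(\<lambda>m. x ^ n * (a (m + n) * x ^ m)) sums (x ^ n * 0)"
      using less by (simp add: power_add mult_ac)
    then show ?thesis
      using x by (subst (asm) sums_mult_iff) auto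
  qed
  then have "((\<lambda>_. 0 :: complex) \<longlongrightarrow> a (0 + n)) (at (0 :: complex))"
    using powser_limit_0_strong[of 1 "\<lambda>m. a (m + n)" "\<lambda>_. 0"] by auto
  then show ?case
    using tendsto_unique[OF _ _ tendsto_const, of "at (0::complex)"] by fastforce
qed

lemma qpar_nonzero [simp]: "qpar N z \<noteq> 0"
  by (simp add: qpar_def)

lemma qpar_surj:
  assumes "N \<ge> 1" "x \<noteq> 0" "norm x < 1"
  obtains z where "z \<in> upper_half" "qpar N z = x"
proof
  define z where "z = of_nat N * Ln x / (2 * of_real pi * \<i>)"
  have "2 * of_real pi * \<i> * z / of_nat N = Ln x"
    using assms(1) by (simp add: z_def field_simps)
  then show "qpar N z = x"
    using assms(2) by (simp add: qpar_def)
  \<comment> \<open>In this form the imaginary part of \<open>z\<close> is read off from the real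
    part \<open>ln (norm x)\<close> of the logarithm, which is negative.\<close>
  have "z = - (\<i> * (of_real (real N / (2 * pi)) * Ln x))"
    by (simp add: z_def field_simps)
  then have "Im z = real N / (2 * pi) * (- ln (norm x))"
    using assms(2) by (simp del: of_real_divide)
  moreover have "ln (norm x) < 0" using assms by simp
  ultimately have "Im z > 0"
    using assms(1) by (simp only:) (intro mult_pos_pos, auto)
  then show "z \<in> upper_half" by (simp add: upper_half_def)
qed

lemma q_series_unique:
  assumes "N \<ge> 1"
    and "\<And>z. z \<in> upper_half \<Longrightarrow> ((\<lambda>m. a m * qpar N z ^ m) has_sum 0) UNIV"
  shows "a m = 0"
proof (rule powser_punctured_zero)
  fix x :: complex assume "x \<noteq> 0" "norm x < 1"
  then obtain z where "z \<in> upper_half" "qpar N z = x"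
    using qpar_surj assms(1) by blast
  then show "(\<lambda>n. a n * x ^ n) sums 0"
    using assms(2)[of z] has_sum_imp_sums by blast
qed

lemma has_q_expansion_lincomb:
  assumes "has_q_expansion N f c" "has_q_expansion N g d"
  shows "has_q_expansion N (\<lambda>z. \<alpha> * f z + \<beta> * g z) (\<lambda>m1 m2. \<alpha> * c m1 m2 + \<beta> * d m1 m2)"
  unfolding has_q_expansion_def
proof (intro ballI)
  fix z1 z2 assume z: "z1 \<in> upper_half" "z2 \<in> upper_half"
  have "((\<lambda>p. \<alpha> * (case p of (m1, m2) \<Rightarrow> c m1 m2 * qpar N z1 ^ m1 * qpar N z2 ^ m2) +
             \<beta> * (case p of (m1, m2) \<Rightarrow> d m1 m2 * qpar N z1 ^ m1 * qpar N z2 ^ m2))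
        has_sum \<alpha> * f (z1, z2) + \<beta> * g (z1, z2)) UNIV"
    using assms z by (intro has_sum_add has_sum_cmult_right) (auto simp: has_q_expansion_def)
  then show "((\<lambda>(m1, m2). (\<alpha> * c m1 m2 + \<beta> * d m1 m2) * qpar N z1 ^ m1 * qpar N z2 ^ m2)
        has_sum \<alpha> * f (z1, z2) + \<beta> * g (z1, z2)) UNIV"
    by (simp add: case_prod_unfold algebra_simps)
qed

text \<open>For fixed \<open>z2\<close>, summing over \<open>m2\<close> first leaves a power series
  in \<open>qpar N z1\<close> with value 0, so every row sum \<open>A m1\<close> vanishes. Each row
  sum is in turn a vanishing power series in \<open>qpar N z2\<close>.\<close>

lemma has_q_expansion_zero_unique:
  assumes "N \<ge> 1" "has_q_expansion N f c"
    and "\<And>z1 z2. z1 \<in> upper_half \<Longrightarrow> z2 \<in> upper_half \<Longrightarrow> f (z1, z2) = 0"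
  shows "c m1 m2 = 0"
proof -
  have "((\<lambda>m2. c m1 m2 * qpar N z2 ^ m2) has_sum 0) UNIV" if z2: "z2 \<in> upper_half" for m1 z2
  proof -
    define A where "A m1 = (\<Sum>\<^sub>\<infinity>m2. c m1 m2 * qpar N z2 ^ m2)" for m1
    have row: "(\<lambda>m2. c m1 m2 * qpar N z2 ^ m2) summable_on UNIV" 
      and tot: "((\<lambda>m1. A m1 * qpar N z1 ^ m1) has_sum 0) UNIV" if z1: "z1 \<in> upper_half" for z1 m1
    proof -
      have "((\<lambda>(m1, m2). c m1 m2 * qpar N z1 ^ m1 * qpar N z2 ^ m2) has_sum f (z1, z2)) UNIV"
        using assms(2) z1 z2 unfolding has_q_expansion_def by blast
      then have *: "((\<lambda>(m1, m2). c m1 m2 * qpar N z1 ^ m1 * qpar N z2 ^ m2) has_sum 0) (UNIV \<times>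
          UNIV)"
        unfolding assms(3)[OF z1 z2] UNIV_Times_UNIV .
      have row: "(\<lambda>m2. c m1 m2 * qpar N z2 ^ m2) summable_on UNIV" for m1
      proof -
        have "(\<lambda>(m1, m2). c m1 m2 * qpar N z1 ^ m1 * qpar N z2 ^ m2) summable_on (UNIV \<times> UNIV)"
          using * has_sum_imp_summable by blast
        then have "(\<lambda>m2. c m1 m2 * qpar N z1 ^ m1 * qpar N z2 ^ m2) summable_on UNIV"
          using summable_on_SigmaD1[of "\<lambda>m1 m2. c m1 m2 * qpar N z1 ^ m1 * qpar N z2 ^ m2" UNIV
              "\<lambda>_. UNIV" m1] by simp
        then have "(\<lambda>m2. inverse (qpar N z1 ^ m1) * (c m1 m2 * qpar N z1 ^ m1 * qpar N z2 ^ m2))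
            summable_on UNIV"
          by (rule summable_on_cmult_right)
        then show ?thesis by (simp add: field_simps)
      qed
      then show "(\<lambda>m2. c m1 m2 * qpar N z2 ^ m2) summable_on UNIV" .
      have "((\<lambda>m2. c m1 m2 * qpar N z1 ^ m1 * qpar N z2 ^ m2) has_sum (A m1 * qpar N z1 ^ m1))
          UNIV" for m1
      proof -
        have "((\<lambda>m2. (c m1 m2 * qpar N z2 ^ m2) * qpar N z1 ^ m1) has_sum (A m1 * qpar N z1 ^ m1))
            UNIV"
          unfolding A_def by (intro has_sum_cmult_left has_sum_infsum row)
        then show ?thesis by (simp add: mult_ac)
      qed
      then show "((\<lambda>m1. A m1 * qpar N z1 ^ m1) has_sum 0) UNIV"
        using has_sum_SigmaD[OF *, of "\<lambda>m1. A m1 * qpar N z1 ^ m1"] by simp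
    qed
    \<comment> \<open>Some value of \<open>z1\<close> is needed to obtain summability of the row,
      although the row itself does not involve it.\<close>
    have "\<i> \<in> upper_half" by (simp add: upper_half_def)
    moreover have "A m1 = 0"
      using q_series_unique[OF assms(1) tot] .
    ultimately show ?thesis
      using row[of \<i> m1] unfolding A_def by (metis has_sum_infsum)
  qed
  then show ?thesis
    using q_series_unique[OF assms(1), of "c m1" m2] by simp
qed

lemma has_q_expansion_unique:
  assumes "N \<ge> 1" "has_q_expansion N f c" "has_q_expansion N g d"
    and "\<And>z1 z2. z1 \<in> upper_half \<Longrightarrow> z2 \<in> upper_half \<Longrightarrow> f (z1, z2) = g (z1, z2)"
  shows "c = d"
proof (intro ext)
  fix m1 m2
  have "has_q_expansion N (\<lambda>z. 1 * f z + (-1) * g z) (\<lambda>m1 m2. 1 * c m1 m2 + (-1) * d m1 m2)"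
    by (rule has_q_expansion_lincomb) fact+
  then have "1 * c m1 m2 + (-1) * d m1 m2 = 0"
    by (rule has_q_expansion_zero_unique[OF assms(1)]) (simp add: assms(4))
  then show "c m1 m2 = d m1 m2" by simp
qed

lemma fourier_coeff_eq:
  assumes "N \<ge> 1" "has_q_expansion N f c"
  shows "fourier_coeff N f = c"
  unfolding fourier_coeff_def using assms has_q_expansion_unique[OF assms(1)] by blast

lemma has_q_expansion_cong:
  assumes "has_q_expansion N f c"
    and "\<And>z1 z2. z1 \<in> upper_half \<Longrightarrow> z2 \<in> upper_half \<Longrightarrow> f (z1, z2) = g (z1, z2)"
  shows "has_q_expansion N g c"
  using assms by (simp add: has_q_expansion_def)

lemma has_q_expansion_sum:
  assumes "finite I" "\<And>i. i \<in> I \<Longrightarrow> has_q_expansion N (f i) (c i)"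
  shows "has_q_expansion N (\<lambda>z. \<Sum>i\<in>I. f i z) (\<lambda>m1 m2. \<Sum>i\<in>I. c i m1 m2)"
  using assms
proof (induction I rule: finite_induct)
  case empty
  then show ?case by (simp add: has_q_expansion_def case_prod_unfold)
next
  case (insert i I)
  then have "has_q_expansion N (\<lambda>z. 1 * f i z + 1 * (\<Sum>i\<in>I. f i z))
      (\<lambda>m1 m2. 1 * c i m1 m2 + 1 * (\<Sum>i\<in>I. c i m1 m2))"
    by (intro has_q_expansion_lincomb) auto
  then show ?case using insert by simp
qed

lemma has_q_expansion_scale:
  assumes "has_q_expansion N f c"
  shows "has_q_expansion N (\<lambda>z. \<alpha> * f z) (\<lambda>m1 m2. \<alpha> * c m1 m2)"
  using has_q_expansion_lincomb[OF assms assms, of \<alpha> 0] by simp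

lemma has_q_expansion_translate:
  assumes "has_q_expansion N f c"
  shows "has_q_expansion N (\<lambda>(z1, z2). f (z1 + of_real x, z2 + of_real y))
    (\<lambda>m1 m2. c m1 m2 * qpar N (of_real x) ^ m1 * qpar N (of_real y) ^ m2)"
  unfolding has_q_expansion_def
proof (intro ballI, unfold prod.case)
  fix z1 z2 assume z: "z1 \<in> upper_half" "z2 \<in> upper_half"
  have shift: "qpar N (w + of_real t) = qpar N w * qpar N (of_real t)" for w t
    by (simp add: qpar_def exp_add[symmetric] add_divide_distrib ring_distribs)
  have "z1 + of_real x \<in> upper_half" "z2 + of_real y \<in> upper_half"
    using z by (simp_all add: upper_half_def)
  then have "((\<lambda>(m1, m2). c m1 m2 * qpar N (z1 + of_real x) ^ m1 * qpar N (z2 + of_real y) ^ m2)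
        has_sum f (z1 + of_real x, z2 + of_real y)) UNIV"
    using assms unfolding has_q_expansion_def by blast
  then show "((\<lambda>(m1, m2). c m1 m2 * qpar N (of_real x) ^ m1 * qpar N (of_real y) ^ m2 * qpar N z1
      ^ m1 * qpar N z2 ^ m2)
        has_sum f (z1 + of_real x, z2 + of_real y)) UNIV"
    unfolding shift power_mult_distrib by (simp only: mult_ac)
qed


subsection \<open>The \<open>q\<close>-expansion of a Hecke translate\<close>

lemma has_sum_reindex_support:
  assumes "inj h" "\<And>x. x \<notin> range h \<Longrightarrow> F x = 0"
  shows "(F has_sum S) UNIV \<longleftrightarrow> ((\<lambda>x. F (h x)) has_sum S) UNIV"
proof -
  have "(F has_sum S) UNIV \<longleftrightarrow> (F has_sum S) (range h)"
    using assms(2) by (intro has_sum_cong_neutral) auto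
  also have "\<dots> \<longleftrightarrow> ((\<lambda>x. F (h x)) has_sum S) UNIV"
    using has_sum_reindex[OF assms(1), of F S] by (simp add: o_def)
  finally show ?thesis .
qed

lemma exp_two_pi_eq_1_iff:
  assumes "d > 0"
  shows "exp (2 * of_real pi * \<i> * of_int m / of_nat d) = 1 \<longleftrightarrow> int d dvd m"
proof -
  have eq: "2 * of_real pi * \<i> * of_int m / of_nat d = \<i> * of_real (2 * pi * of_int m / of_nat d)"
    by simp
  have "exp (2 * of_real pi * \<i> * of_int m / of_nat d) = 1 \<longleftrightarrow>
      (\<exists>n::int. 2 * pi * of_int m / of_nat d = of_int (2 * n) * pi)"
    unfolding eq exp_eq_1 by simp
  also have "\<dots> \<longleftrightarrow> (\<exists>n::int. real_of_int m = of_int (int d * n))"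
    using assms by (intro arg_cong[of _ _ Ex] ext) (simp add: field_simps)
  also have "\<dots> \<longleftrightarrow> int d dvd m"
    by (simp only: of_int_eq_iff dvd_def)
  finally show ?thesis .
qed

lemma sum_roots_of_unity:
  assumes "d > 0"
  shows "(\<Sum>b<d. exp (2 * of_real pi * \<i> * of_int m / of_nat d) ^ b) =
    (if int d dvd m then of_nat d else (0 :: complex))"
proof (cases "int d dvd m")
  case True
  then show ?thesis using exp_two_pi_eq_1_iff[OF assms, of m] by simp
next
  case False
  have "exp (2 * of_real pi * \<i> * of_int m / of_nat d) ^ d =
      exp (2 * of_real pi * \<i> * of_int m / of_nat (1 :: nat))"
    using assms by (simp add: exp_of_nat_mult[symmetric])
  also have "\<dots> = 1" by (subst exp_two_pi_eq_1_iff) auto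
  finally show ?thesis
    using False exp_two_pi_eq_1_iff[OF assms, of m] by (simp add: geometric_sum)
qed

lemma has_sum_finite_sum:
  fixes F :: "'i \<Rightarrow> 'a \<Rightarrow> complex"
  assumes "finite I" "\<And>i. i \<in> I \<Longrightarrow> (F i has_sum S i) A"
  shows "((\<lambda>x. \<Sum>i\<in>I. F i x) has_sum (\<Sum>i\<in>I. S i)) A"
  using assms by (induction I rule: finite_induct) (auto intro!: has_sum_add)

text \<open>The shift by \<open>b N / d\<close> multiplies the term of exponent \<open>m\<close> by
  the \<open>b\<close>-th power of exp(2 pi i m / d). Summing over \<open>b\<close> keeps exactly
  the exponents \<open>m = d m'\<close>, with a factor \<open>d\<close>, and the scaling by
  \<open>a / d\<close> turns them into \<open>a m'\<close>.\<close>

lemma has_q_expansion_average: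
  assumes N: "N \<ge> 1" and pos: "a1 > 0" "d1 > 0" "a2 > 0" "d2 > 0"
    and g: "has_q_expansion N g c"
  shows "has_q_expansion N
    (\<lambda>(z1, z2). \<Sum>(b1, b2)\<in>{..<d1} \<times> {..<d2}.
       g ((of_nat a1 * z1 + of_nat (b1 * N)) / of_nat d1, (of_nat a2 * z2 + of_nat (b2 * N)) /
           of_nat d2))
    (\<lambda>m1 m2. if a1 dvd m1 \<and> a2 dvd m2
       then of_nat (d1 * d2) * c (m1 div a1 * d1) (m2 div a2 * d2) else 0)"
  unfolding has_q_expansion_def
proof (intro ballI, unfold prod.case)
  fix z1 z2 assume z: "z1 \<in> upper_half" "z2 \<in> upper_half"
  define w where "w a d b z = (of_nat a * z + of_nat (b * N)) / of_nat d" for a d b :: nat and z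
      :: complex
  define E1 where "E1 = qpar N (of_nat a1 * z1 / of_nat d1)"
  define E2 where "E2 = qpar N (of_nat a2 * z2 / of_nat d2)"
  define R where "R d m = (\<Sum>b<d. exp (2 * of_real pi * \<i> * of_int (int m) / of_nat d) ^ b)" for d m
  define S where "S = (\<Sum>(b1, b2)\<in>{..<d1} \<times> {..<d2}. g (w a1 d1 b1 z1, w a2 d2 b2 z2))"
  have R: "R d m = (if d dvd m then of_nat d else 0)" if "d > 0" for d m
    unfolding R_def sum_roots_of_unity[OF that] int_dvd_int_iff ..
  have w_in: "w a d b z \<in> upper_half" if "a > 0" "d > 0" "z \<in> upper_half" for a d b z
  proof -
    have "w a d b z = of_real (real a / real d) * z + of_real (real (b * N) / real d)"
      by (simp add: w_def add_divide_distrib)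
    then show ?thesis
      using that by (simp add: upper_half_def del: of_real_divide)
  qed
  have q_w: "qpar N (w a d b z) ^ m = qpar N (of_nat a * z / of_nat d) ^ m *
      exp (2 * of_real pi * \<i> * of_int (int m) / of_nat d) ^ b" if "d > 0" for a d b z m
    unfolding qpar_def w_def exp_of_nat_mult[symmetric] exp_add[symmetric]
    using N that by (intro arg_cong[of _ _ exp]) (simp add: field_simps)
  have "((\<lambda>p. \<Sum>b\<in>{..<d1} \<times> {..<d2}. (case p of (m1, m2) \<Rightarrow>
      c m1 m2 * qpar N (w a1 d1 (fst b) z1) ^ m1 * qpar N (w a2 d2 (snd b) z2) ^ m2)) has_sum
      (\<Sum>b\<in>{..<d1} \<times> {..<d2}. g (w a1 d1 (fst b) z1, w a2 d2 (snd b) z2))) UNIV"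
    using g w_in z pos unfolding has_q_expansion_def by (intro has_sum_finite_sum) auto
  moreover have "(\<Sum>b\<in>{..<d1} \<times> {..<d2}. (case p of (m1, m2) \<Rightarrow>
      c m1 m2 * qpar N (w a1 d1 (fst b) z1) ^ m1 * qpar N (w a2 d2 (snd b) z2) ^ m2)) =
      (case p of (m1, m2) \<Rightarrow> c m1 m2 * E1 ^ m1 * E2 ^ m2 * (R d1 m1 * R d2 m2))" for p
  proof (cases p)
    case (Pair m1 m2)
    have "R d1 m1 * R d2 m2 = (\<Sum>b\<in>{..<d1} \<times> {..<d2}.
        exp (2 * of_real pi * \<i> * of_int (int m1) / of_nat d1) ^ fst b *
        exp (2 * of_real pi * \<i> * of_int (int m2) / of_nat d2) ^ snd b)"
      unfolding R_def sum_product sum.cartesian_product case_prod_unfold ..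
    then show ?thesis
      unfolding Pair prod.case q_w[OF pos(2)] q_w[OF pos(4)] E1_def[symmetric] E2_def[symmetric]
        sum_distrib_left by (simp add: sum_distrib_left mult_ac)
  qed
  ultimately have "((\<lambda>(m1, m2). c m1 m2 * E1 ^ m1 * E2 ^ m2 * (R d1 m1 * R d2 m2)) has_sum S) UNIV"
    unfolding S_def case_prod_unfold by simp
  \<comment> \<open>First reindexing: only exponents divisible by \<open>d1\<close> and
    \<open>d2\<close> contribute.\<close>
  then have "((\<lambda>p. case (\<lambda>(m1, m2). (m1 * d1, m2 * d2)) p of (m1, m2) \<Rightarrow>
      c m1 m2 * E1 ^ m1 * E2 ^ m2 * (R d1 m1 * R d2 m2)) has_sum S) UNIV"
  proof (subst (asm) has_sum_reindex_support[where h = "\<lambda>(m1, m2). (m1 * d1, m2 * d2)"])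
    fix p :: "nat \<times> nat"
    assume p: "p \<notin> range (\<lambda>(m1, m2). (m1 * d1, m2 * d2))"
    obtain m1 m2 where [simp]: "p = (m1, m2)" by (cases p)
    have "\<not> (d1 dvd m1 \<and> d2 dvd m2)"
    proof
      assume "d1 dvd m1 \<and> d2 dvd m2"
      then have "p = (\<lambda>(m1, m2). (m1 * d1, m2 * d2)) (m1 div d1, m2 div d2)" by simp
      then show False using p by blast
    qed
    then have "R d1 m1 = 0 \<or> R d2 m2 = 0"
      using pos by (auto simp: R)
    then show "(case p of (m1, m2) \<Rightarrow> c m1 m2 * E1 ^ m1 * E2 ^ m2 * (R d1 m1 * R d2 m2)) = 0"
      by auto
  qed (use pos in \<open>auto simp: inj_on_def\<close>)
  moreover have "E1 ^ d1 = qpar N z1 ^ a1" "E2 ^ d2 = qpar N z2 ^ a2"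
    unfolding E1_def E2_def qpar_def exp_of_nat_mult[symmetric]
    using pos by (intro arg_cong[of _ _ exp]; simp)+
  then have "E1 ^ (d1 * m) = qpar N z1 ^ (a1 * m)" "E2 ^ (d2 * m) = qpar N z2 ^ (a2 * m)" for m
    by (simp_all add: power_mult)
  ultimately have *: "((\<lambda>(m1, m2). of_nat (d1 * d2) * c (m1 * d1) (m2 * d2) *
      qpar N z1 ^ (m1 * a1) * qpar N z2 ^ (m2 * a2)) has_sum S) UNIV"
    using pos by (simp add: case_prod_unfold R mult_ac)
  \<comment> \<open>Second reindexing, in the opposite direction: the result is a series in
    \<open>qpar N z1 ^ a1\<close> and \<open>qpar N z2 ^ a2\<close>, to be filled up with zero
    coefficients at all other exponents.\<close>
  define G where "G = (\<lambda>(m1, m2). (if a1 dvd m1 \<and> a2 dvd m2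
      then of_nat (d1 * d2) * c (m1 div a1 * d1) (m2 div a2 * d2) else 0) * qpar N z1 ^ m1 * qpar
          N z2 ^ m2)"
  have "((\<lambda>p. G ((\<lambda>(m1, m2). (m1 * a1, m2 * a2)) p)) has_sum S) UNIV"
    using * pos by (simp add: G_def case_prod_unfold)
  then have "(G has_sum S) UNIV"
  proof (subst has_sum_reindex_support[where h = "\<lambda>(m1, m2). (m1 * a1, m2 * a2)"])
    fix p :: "nat \<times> nat"
    assume p: "p \<notin> range (\<lambda>(m1, m2). (m1 * a1, m2 * a2))"
    obtain m1 m2 where [simp]: "p = (m1, m2)" by (cases p)
    have "\<not> (a1 dvd m1 \<and> a2 dvd m2)"
    proof
      assume "a1 dvd m1 \<and> a2 dvd m2"
      then have "p = (\<lambda>(m1, m2). (m1 * a1, m2 * a2)) (m1 div a1, m2 div a2)" by simp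
      then show False using p by blast
    qed
    then show "G p = 0" by (auto simp: G_def)
  qed (use pos in \<open>auto simp: inj_on_def\<close>)
  then show "((\<lambda>(m1, m2). (if a1 dvd m1 \<and> a2 dvd m2
       then of_nat (d1 * d2) * c (m1 div a1 * d1) (m2 div a2 * d2) else 0) * qpar N z1 ^ m1 * qpar
           N z2 ^ m2)
     has_sum (\<Sum>(b1, b2)\<in>{..<d1} \<times> {..<d2}.
       g ((of_nat a1 * z1 + of_nat (b1 * N)) / of_nat d1, (of_nat a2 * z2 + of_nat (b2 * N)) /
           of_nat d2))) UNIV"
    unfolding G_def S_def w_def .
qed

section \<open>The matrices \<open>sigma_mat\<close> and the coefficients of a Hecke
  translate\<close>

lemma sigma_mat_exists:
  assumes "N \<ge> 1" "coprime a N"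
  shows "\<exists>s. s \<in> SL2Z \<and>
     [s $ 1 $ 1 * int a = 1] (mod int N) \<and> [s $ 1 $ 2 = 0] (mod int N) \<and>
     [s $ 2 $ 1 = 0] (mod int N) \<and> [s $ 2 $ 2 = int a] (mod int N)"
proof -
  \<comment> \<open>Inverting \<open>a\<close> modulo the square of \<open>N\<close> lets both
    off-diagonal entries of the witness be multiples of \<open>N\<close>.\<close>
  have "coprime (int a) (int N * int N)" using assms(2) by simp
  then obtain x where "[int a * x = 1] (mod (int N * int N))"
    using cong_solve_coprime_int by blast
  then obtain t where t: "int a * x - 1 = int N * int N * t"
    unfolding cong_iff_dvd_diff by (auto elim: dvdE)
  have "[x * int a = 1] (mod int N)"
    unfolding cong_iff_dvd_diff using t by (metis dvd_triv_left mult.assoc mult.commute)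
  then show ?thesis
    using t by (intro exI[of _ "mat2 x (int N * t) (int N) (int a)"])
      (simp add: SL2Z_def cong_iff_dvd_diff algebra_simps)
qed

lemma sigma_mat_spec:
  assumes "N \<ge> 1" "coprime a N"
  shows "sigma_mat N a \<in> SL2Z" "[sigma_mat N a $ 1 $ 1 * int a = 1] (mod int N)"
    "[sigma_mat N a $ 1 $ 2 = 0] (mod int N)" "[sigma_mat N a $ 2 $ 1 = 0] (mod int N)"
    "[sigma_mat N a $ 2 $ 2 = int a] (mod int N)"
  using someI_ex[OF sigma_mat_exists[OF assms]] unfolding sigma_mat_def by blast+

lemma slash_hecke_mat:
  assumes "N \<ge> 1" "a1 > 0" "d1 > 0" "a2 > 0" "d2 > 0" "coprime a1 N" "coprime a2 N"
    and "z1 \<in> upper_half" "z2 \<in> upper_half"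
  shows "slash k (hecke_mat N (a1, b1, d1), hecke_mat N (a2, b2, d2)) f (z1, z2) =
    (of_real (real (a1 * d1) powr (- 1 / 2)) * of_nat d1) powi (- fst k) *
    (of_real (real (a2 * d2) powr (- 1 / 2)) * of_nat d2) powi (- snd k) *
    slash k (sigma_mat N a1, sigma_mat N a2) f
     ((of_nat a1 * z1 + of_nat (b1 * N)) / of_nat d1, (of_nat a2 * z2 + of_nat (b2 * N)) / of_nat
         d2)"
proof -
  have "det (sigma_mat N a1) = 1" "det (sigma_mat N a2) = 1"
    using sigma_mat_spec(1) assms by (auto simp: SL2Z_def)
  then have "slash k (hecke_mat N (a1, b1, d1), hecke_mat N (a2, b2, d2)) f (z1, z2) =
    slash k (mat2 (int a1) (int b1 * int N) 0 (int d1), mat2 (int a2) (int b2 * int N) 0 (int d2))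
      (slash k (sigma_mat N a1, sigma_mat N a2) f) (z1, z2)"
    unfolding hecke_mat_def prod.case using assms by (intro slash_mult) auto
  then show ?thesis
    by (subst (asm) (2) slash_def) (simp add: moeb_upper_triangular aut_factor_upper_triangular)
qed

text \<open>With \<open>n = a d\<close>, the powers of \<open>n\<close> combine to exponent
  \<open>k - 1\<close> and the slash contributes \<open>d\<close> to the power \<open>- k\<close>;
  the last factor \<open>d\<close> comes from the sum over the \<open>d\<close> translates. What
  remains depends on \<open>a\<close> alone.\<close>

lemma hecke_weight_eq:
  assumes "a > 0" "d > 0"
  shows "of_real (real (a * d) powr (real_of_int k / 2 - 1)) *
      (of_real (real (a * d) powr (- 1 / 2)) * of_nat d) powi (- k) * of_nat d =
    (of_nat a powi (k - 1) :: complex)"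
proof -
  define x y where "x = real a" and "y = real d"
  have xy: "x > 0" "y > 0" using assms by (auto simp: x_def y_def)
  have "(x * y) powr (real_of_int k / 2 - 1) * ((x * y) powr (- 1 / 2) * y) powi (- k) * y =
    (x * y) powr (real_of_int k / 2 - 1) * ((x * y) powr (- 1 / 2) * y) powr real_of_int (- k) * y
        powr 1"
    using xy by (subst powr_real_of_int') auto
  also have "\<dots> = (x powr (real_of_int k / 2 - 1) * x powr (real_of_int k / 2)) *
      (y powr (real_of_int k / 2 - 1) * y powr (real_of_int k / 2) * y powr (- real_of_int k) * y
          powr 1)"
    using xy by (simp add: powr_mult powr_powr mult_ac)
  also have "\<dots> = x powr real_of_int (k - 1)"
    using xy by (simp only: powr_add[symmetric]) simp
  also have "\<dots> = x powi (k - 1)"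
    using xy by (subst powr_real_of_int') auto
  finally have "complex_of_real ((x * y) powr (real_of_int k / 2 - 1) *
      ((x * y) powr (- 1 / 2) * y) powi (- k) * y) = complex_of_real (x powi (k - 1))"
    by (rule arg_cong)
  then show ?thesis by (simp add: x_def y_def of_real_power_int)
qed

lemma hecke_reps_eq:
  assumes "n > 0"
  shows "hecke_reps n = (\<lambda>(a, b). (a, b, n div a)) ` (SIGMA a:{a. a dvd n}. {..<n div a})"
proof (intro equalityI subsetI)
  fix r assume "r \<in> hecke_reps n"
  then obtain a b d where "r = (a, b, d)" "a > 0" "d > 0" "a * d = n" "b < d"
    by (auto simp: hecke_reps_def)
  then show "r \<in> (\<lambda>(a, b). (a, b, n div a)) ` (SIGMA a:{a. a dvd n}. {..<n div a})"
    by (intro image_eqI[of _ _ "(a, b)"]) auto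
next
  fix r assume "r \<in> (\<lambda>(a, b). (a, b, n div a)) ` (SIGMA a:{a. a dvd n}. {..<n div a})"
  then show "r \<in> hecke_reps n"
    using assms by (auto simp: hecke_reps_def intro!: Nat.gr0I)
qed

lemma sum_hecke_reps:
  assumes "n > 0"
  shows "(\<Sum>r\<in>hecke_reps n. F r) = (\<Sum>a | a dvd n. \<Sum>b<n div a. F (a, b, n div a))"
proof -
  have "(\<Sum>r\<in>hecke_reps n. F r) = (\<Sum>(a, b)\<in>(SIGMA a:{a. a dvd n}. {..<n div a}). F (a, b, n div a))"
    unfolding hecke_reps_eq[OF assms]
    by (subst sum.reindex) (auto simp: inj_on_def case_prod_unfold o_def)
  also have "\<dots> = (\<Sum>a | a dvd n. \<Sum>b<n div a. F (a, b, n div a))"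
    using assms by (subst sum.Sigma) auto
  finally show ?thesis .
qed

text \<open>Group the representatives by \<open>(a1, a2)\<close>. Within a group, the sum over
  \<open>(b1, b2)\<close> runs over translates of one form, \<open>f\<close> slashed with
  \<open>(sigma_mat N a1, sigma_mat N a2)\<close>, so \<open>has_q_expansion_average\<close>
  applies.\<close>

lemma hecke_q_expansion:
  assumes N: "N \<ge> 1" and n: "n1 > 0" "n2 > 0" "coprime n1 N" "coprime n2 N"
    and c: "\<And>a1 a2. a1 dvd n1 \<Longrightarrow> a2 dvd n2 \<Longrightarrow>
      has_q_expansion N (slash k (sigma_mat N a1, sigma_mat N a2) f) (c a1 a2)"
  shows "has_q_expansion N (hecke N k n1 n2 f) (\<lambda>m1 m2.
    \<Sum>a1 | a1 dvd n1 \<and> a1 dvd m1. \<Sum>a2 | a2 dvd n2 \<and> a2 dvd m2.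
      of_nat a1 powi (fst k - 1) * of_nat a2 powi (snd k - 1) *
      c a1 a2 (m1 div a1 * (n1 div a1)) (m2 div a2 * (n2 div a2)))"
proof -
  \<comment> \<open>The normalising factors of one variable; together with the factor
    \<open>n div a\<close> from the averaging they reduce to a power of \<open>a\<close>.\<close>
  define W :: "nat \<Rightarrow> nat \<Rightarrow> int \<Rightarrow> complex" where
    "W n a k = of_real (real n powr (real_of_int k / 2 - 1)) *
      (of_real (real n powr (- 1 / 2)) * of_nat (n div a)) powi (- k)" for n a k
  define g where "g a1 a2 = slash k (sigma_mat N a1, sigma_mat N a2) f" for a1 a2
  define A where "A a1 a2 = (\<lambda>(z1, z2). \<Sum>(b1, b2)\<in>{..<n1 div a1} \<times> {..<n2 div a2}.
       g a1 a2 ((of_nat a1 * z1 + of_nat (b1 * N)) / of_nat (n1 div a1),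
                (of_nat a2 * z2 + of_nat (b2 * N)) / of_nat (n2 div a2)))" for a1 a2
  define D where "D = {a1. a1 dvd n1} \<times> {a2. a2 dvd n2}"
  have fin: "finite {a. a dvd n1}" "finite {a. a dvd n2}" "finite D"
    using n by (auto simp: D_def)
  have W: "W n a k * of_nat (n div a) = of_nat a powi (k - 1)" if "n > 0" "a dvd n" for n a k
    using hecke_weight_eq[of a "n div a" k] that by (auto simp: W_def dvd_div_eq_0_iff intro!:
        Nat.gr0I)
  have exp: "has_q_expansion N (\<lambda>z. \<Sum>(a1, a2)\<in>D. W n1 a1 (fst k) * W n2 a2 (snd k) * A a1 a2 z)
    (\<lambda>m1 m2. \<Sum>(a1, a2)\<in>D. W n1 a1 (fst k) * W n2 a2 (snd k) *
      (if a1 dvd m1 \<and> a2 dvd m2 then of_nat (n1 div a1 * (n2 div a2)) *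
        c a1 a2 (m1 div a1 * (n1 div a1)) (m2 div a2 * (n2 div a2)) else 0))"
    unfolding case_prod_unfold A_def
    using n c by (intro has_q_expansion_sum fin has_q_expansion_scale
        has_q_expansion_average[unfolded case_prod_unfold] N)
      (auto simp: D_def g_def intro!: Nat.gr0I simp: dvd_div_eq_0_iff)
  have coeff: "(\<Sum>(a1, a2)\<in>D. W n1 a1 (fst k) * W n2 a2 (snd k) *
      (if a1 dvd m1 \<and> a2 dvd m2 then of_nat (n1 div a1 * (n2 div a2)) *
        c a1 a2 (m1 div a1 * (n1 div a1)) (m2 div a2 * (n2 div a2)) else 0)) =
    (\<Sum>a1 | a1 dvd n1 \<and> a1 dvd m1. \<Sum>a2 | a2 dvd n2 \<and> a2 dvd m2.
      of_nat a1 powi (fst k - 1) * of_nat a2 powi (snd k - 1) *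
      c a1 a2 (m1 div a1 * (n1 div a1)) (m2 div a2 * (n2 div a2)))" for m1 m2
  proof -
    have "(\<Sum>a1 | a1 dvd n1 \<and> a1 dvd m1. \<Sum>a2 | a2 dvd n2 \<and> a2 dvd m2.
      of_nat a1 powi (fst k - 1) * of_nat a2 powi (snd k - 1) *
      c a1 a2 (m1 div a1 * (n1 div a1)) (m2 div a2 * (n2 div a2))) =
      (\<Sum>(a1, a2)\<in>{a1. a1 dvd n1 \<and> a1 dvd m1} \<times> {a2. a2 dvd n2 \<and> a2 dvd m2}.
      of_nat a1 powi (fst k - 1) * of_nat a2 powi (snd k - 1) *
      c a1 a2 (m1 div a1 * (n1 div a1)) (m2 div a2 * (n2 div a2)))"
      by (rule sum.cartesian_product)
    also have "\<dots> = (\<Sum>(a1, a2)\<in>D. W n1 a1 (fst k) * W n2 a2 (snd k) *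
      (if a1 dvd m1 \<and> a2 dvd m2 then of_nat (n1 div a1 * (n2 div a2)) *
        c a1 a2 (m1 div a1 * (n1 div a1)) (m2 div a2 * (n2 div a2)) else 0))"
      using n fin by (intro sum.mono_neutral_cong_left)
        (auto simp: D_def W[symmetric] mult_ac split: if_splits)
    finally show ?thesis ..
  qed
  have "hecke N k n1 n2 f (z1, z2) = (\<Sum>(a1, a2)\<in>D. W n1 a1 (fst k) * W n2 a2 (snd k) * A a1 a2
      (z1, z2))"
    if z: "z1 \<in> upper_half" "z2 \<in> upper_half" for z1 z2
  proof -
    define P :: complex where "P = of_real (real n1 powr (real_of_int (fst k) / 2 - 1) *
              real n2 powr (real_of_int (snd k) / 2 - 1))"
    define F where "F r1 r2 = slash k (hecke_mat N r1, hecke_mat N r2) f (z1, z2)" for r1 r2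
    have "hecke N k n1 n2 f (z1, z2) = P * (\<Sum>r1\<in>hecke_reps n1. \<Sum>r2\<in>hecke_reps n2. F r1 r2)"
      by (simp add: hecke_def P_def F_def sum.cartesian_product)
    also have "(\<Sum>r1\<in>hecke_reps n1. \<Sum>r2\<in>hecke_reps n2. F r1 r2) =
      (\<Sum>a1 | a1 dvd n1. \<Sum>b1<n1 div a1. \<Sum>a2 | a2 dvd n2. \<Sum>b2<n2 div a2. F (a1, b1, n1 div a1) (a2,
          b2, n2 div a2))"
      by (simp add: sum_hecke_reps n)
    also have "\<dots> = (\<Sum>a1 | a1 dvd n1. \<Sum>a2 | a2 dvd n2. \<Sum>b1<n1 div a1. \<Sum>b2<n2 div a2. F (a1, b1, n1
        div a1) (a2, b2, n2 div a2))"
      by (intro sum.cong refl sum.swap)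
    also have "\<dots> = (\<Sum>(a1, a2)\<in>D. \<Sum>(b1, b2)\<in>{..<n1 div a1} \<times> {..<n2 div a2}. F (a1, b1, n1 div a1)
        (a2, b2, n2 div a2))"
      by (simp add: D_def sum.cartesian_product)
    also have "P * \<dots> = (\<Sum>(a1, a2)\<in>D. W n1 a1 (fst k) * W n2 a2 (snd k) * A a1 a2 (z1, z2))"
      unfolding sum_distrib_left
    proof (intro sum.cong refl, clarify)
      fix a1 a2 assume "(a1, a2) \<in> D"
      then have a: "a1 dvd n1" "a2 dvd n2" by (auto simp: D_def)
      have "a1 > 0" "a2 > 0" "n1 div a1 > 0" "n2 div a2 > 0"
        using n a by (auto intro!: Nat.gr0I simp: dvd_div_eq_0_iff)
      moreover have "coprime a1 N" "coprime a2 N"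
        using coprime_divisors[OF a(1) dvd_refl n(3)] coprime_divisors[OF a(2) dvd_refl n(4)] .
      ultimately have "F (a1, b1, n1 div a1) (a2, b2, n2 div a2) =
        (of_real (real n1 powr (- 1 / 2)) * of_nat (n1 div a1)) powi (- fst k) *
        (of_real (real n2 powr (- 1 / 2)) * of_nat (n2 div a2)) powi (- snd k) *
         g a1 a2 ((of_nat a1 * z1 + of_nat (b1 * N)) / of_nat (n1 div a1),
                (of_nat a2 * z2 + of_nat (b2 * N)) / of_nat (n2 div a2))" for b1 b2
        using slash_hecke_mat[OF N, of a1 "n1 div a1" a2 "n2 div a2" z1 z2 k b1 b2 f] z a
        unfolding F_def g_def by simp
      then show "P * (\<Sum>(b1, b2)\<in>{..<n1 div a1} \<times> {..<n2 div a2}. F (a1, b1, n1 div a1) (a2, b2, n2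
          div a2)) =
        W n1 a1 (fst k) * W n2 a2 (snd k) * A a1 a2 (z1, z2)"
        unfolding A_def prod.case W_def P_def sum_distrib_left case_prod_unfold
        by (intro sum.cong refl) (simp add: mult_ac)
    qed
    finally show ?thesis .
  qed
  then show ?thesis
    using has_q_expansion_cong[OF exp[unfolded coeff], of "hecke N k n1 n2 f"] by simp
qed


subsection \<open>Cusp forms and their coefficients\<close>

lemma fourier_coeff_cong:
  assumes "N \<ge> 1" "has_q_expansion N f c"
    and "\<And>z1 z2. z1 \<in> upper_half \<Longrightarrow> z2 \<in> upper_half \<Longrightarrow> f (z1, z2) = g (z1, z2)"
  shows "fourier_coeff N f = fourier_coeff N g"
  using fourier_coeff_eq[OF assms(1,2)] fourier_coeff_eq[OF assms(1) has_q_expansion_cong[OF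
      assms(2,3)]]
  by simp

lemma cusp_formsD:
  assumes "f \<in> cusp_forms N k \<Gamma>"
  shows "z \<notin> upper_half \<times> upper_half \<Longrightarrow> f z = 0"
    and "holomorphic2_on f (upper_half \<times> upper_half)"
    and "\<gamma> \<in> \<Gamma> \<Longrightarrow> z \<in> upper_half \<times> upper_half \<Longrightarrow> slash k \<gamma> f z = f z"
    and "\<gamma> \<in> SL2Z \<times> SL2Z \<Longrightarrow> \<exists>c. has_q_expansion N (slash k \<gamma> f) c \<and>
        (\<forall>m1 m2. m1 = 0 \<or> m2 = 0 \<longrightarrow> c m1 m2 = 0)"
  using assms unfolding cusp_forms_def mem_Collect_eq by (elim conjE, (erule bspec | blast)+)+

lemma cusp_form_slash_q_expansion:
  assumes "N \<ge> 1" "f \<in> cusp_forms N k \<Gamma>" "A \<in> SL2Z" "B \<in> SL2Z"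
  shows "has_q_expansion N (slash k (A, B) f) (fourier_coeff N (slash k (A, B) f))"
    and "m1 = 0 \<or> m2 = 0 \<Longrightarrow> fourier_coeff N (slash k (A, B) f) m1 m2 = 0"
proof -
  obtain c where "has_q_expansion N (slash k (A, B) f) c" "\<forall>m1 m2. m1 = 0 \<or> m2 = 0 \<longrightarrow> c m1 m2 = 0"
    using cusp_formsD(4)[OF assms(2), of "(A, B)"] assms(3,4) by auto
  then show "has_q_expansion N (slash k (A, B) f) (fourier_coeff N (slash k (A, B) f))"
    and "m1 = 0 \<or> m2 = 0 \<Longrightarrow> fourier_coeff N (slash k (A, B) f) m1 m2 = 0"
    using fourier_coeff_eq[OF assms(1)] by auto
qed

lemma mat1_in_SL2Z: "mat 1 \<in> SL2Z"
  by (simp add: SL2Z_def)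

lemma cusp_form_q_expansion:
  assumes "N \<ge> 1" "f \<in> cusp_forms N k \<Gamma>"
  shows "has_q_expansion N f (fourier_coeff N f)"
    and "m1 = 0 \<or> m2 = 0 \<Longrightarrow> fourier_coeff N f m1 m2 = 0"
  using cusp_form_slash_q_expansion[OF assms mat1_in_SL2Z mat1_in_SL2Z] by simp_all

lemma slash_lincomb:
  "slash k \<gamma> (\<lambda>z. \<alpha> * f z + \<beta> * g z) = (\<lambda>z. \<alpha> * slash k \<gamma> f z + \<beta> * slash k \<gamma> g z)"
  by (rule ext) (simp add: slash_def algebra_simps)

lemma hecke_scale: "hecke N k n1 n2 (\<lambda>z. \<alpha> * f z) = (\<lambda>z. \<alpha> * hecke N k n1 n2 f z)"
proof
  fix z
  have "slash k \<gamma> (\<lambda>z. \<alpha> * f z) z = \<alpha> * slash k \<gamma> f z" for \<gamma>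
    by (simp add: slash_def)
  then show "hecke N k n1 n2 (\<lambda>z. \<alpha> * f z) z = \<alpha> * hecke N k n1 n2 f z"
    by (simp add: hecke_def case_prod_unfold sum_distrib_left mult_ac)
qed

lemma cusp_forms_lincomb:
  assumes "f \<in> cusp_forms N k \<Gamma>" "g \<in> cusp_forms N k \<Gamma>"
  shows "(\<lambda>z. \<alpha> * f z + \<beta> * g z) \<in> cusp_forms N k \<Gamma>"
proof -
  have "holomorphic2_on (\<lambda>z. \<alpha> * f z + \<beta> * g z) (upper_half \<times> upper_half)"
    unfolding holomorphic2_on_def
  proof
    fix z :: "complex \<times> complex" assume "z \<in> upper_half \<times> upper_half"
    then have ex: "\<exists>a b. (h has_derivative (\<lambda>h. a * fst h + b * snd h)) (at z)"
      if "h \<in> cusp_forms N k \<Gamma>" for h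
      using cusp_formsD(2)[OF that] unfolding holomorphic2_on_def by (rule bspec[rotated])
    obtain a b where "(f has_derivative (\<lambda>h. a * fst h + b * snd h)) (at z)"
      using ex[OF assms(1)] by (elim exE)
    moreover obtain a' b' where "(g has_derivative (\<lambda>h. a' * fst h + b' * snd h)) (at z)"
      using ex[OF assms(2)] by (elim exE)
    ultimately have "((\<lambda>z. \<alpha> * f z + \<beta> * g z) has_derivative
        (\<lambda>h. \<alpha> * (a * fst h + b * snd h) + \<beta> * (a' * fst h + b' * snd h))) (at z)"
      by (intro has_derivative_add has_derivative_mult_right)
    moreover have "(\<lambda>h. \<alpha> * (a * fst h + b * snd h) + \<beta> * (a' * fst h + b' * snd h)) =
        (\<lambda>h. (\<alpha> * a + \<beta> * a') * fst h + (\<alpha> * b + \<beta> * b') * snd h)"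
      by (simp add: algebra_simps)
    ultimately show "\<exists>a b. ((\<lambda>z. \<alpha> * f z + \<beta> * g z) has_derivative (\<lambda>h. a * fst h + b * snd h))
        (at z)"
      by (intro exI) (simp only:)
  qed
  moreover have "\<exists>c. has_q_expansion N (slash k \<gamma> (\<lambda>z. \<alpha> * f z + \<beta> * g z)) c \<and>
      (\<forall>m1 m2. m1 = 0 \<or> m2 = 0 \<longrightarrow> c m1 m2 = 0)" if \<gamma>: "\<gamma> \<in> SL2Z \<times> SL2Z" for \<gamma>
  proof -
    obtain c where "has_q_expansion N (slash k \<gamma> f) c" "\<forall>m1 m2. m1 = 0 \<or> m2 = 0 \<longrightarrow> c m1 m2 = 0"
      using cusp_formsD(4)[OF assms(1) \<gamma>] by (elim exE conjE)
    moreover obtain d where "has_q_expansion N (slash k \<gamma> g) d" "\<forall>m1 m2. m1 = 0 \<or> m2 = 0 \<longrightarrow> d m1 m2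
        = 0"
      using cusp_formsD(4)[OF assms(2) \<gamma>] by (elim exE conjE)
    ultimately show ?thesis
      unfolding slash_lincomb
      by (intro exI[of _ "\<lambda>m1 m2. \<alpha> * c m1 m2 + \<beta> * d m1 m2"] conjI has_q_expansion_lincomb) auto
  qed
  ultimately show ?thesis
    using assms unfolding cusp_forms_def by (simp add: slash_lincomb)
qed

lemma cusp_forms_zero: "(\<lambda>_. 0) \<in> cusp_forms N k \<Gamma>"
proof -
  have "slash k \<gamma> (\<lambda>_. 0) = (\<lambda>_. 0)" for \<gamma>
    by (rule ext) (simp add: slash_def)
  moreover have "has_q_expansion N (\<lambda>_. 0) (\<lambda>_ _. 0)"
    by (simp add: has_q_expansion_def case_prod_unfold)
  moreover have "holomorphic2_on (\<lambda>_. 0) U" for U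
    unfolding holomorphic2_on_def by (auto intro!: exI[of _ 0])
  ultimately show ?thesis
    by (auto simp: cusp_forms_def)
qed

lemma cusp_forms_scale:
  "f \<in> cusp_forms N k \<Gamma> \<Longrightarrow> (\<lambda>z. \<alpha> * f z) \<in> cusp_forms N k \<Gamma>"
  using cusp_forms_lincomb[of f N k \<Gamma> f \<alpha> 0] by simp

lemma fourier_coeff_lincomb:
  assumes "N \<ge> 1" "f \<in> cusp_forms N k \<Gamma>" "g \<in> cusp_forms N k \<Gamma>"
  shows "fourier_coeff N (\<lambda>z. \<alpha> * f z + \<beta> * g z) m1 m2 =
    \<alpha> * fourier_coeff N f m1 m2 + \<beta> * fourier_coeff N g m1 m2"
  using fourier_coeff_eq[OF assms(1) has_q_expansion_lincomb[OF cusp_form_q_expansion(1)[OF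
      assms(1,2)]
        cusp_form_q_expansion(1)[OF assms(1,3)]]] by metis

lemma fourier_coeff_scale:
  assumes "N \<ge> 1" "f \<in> cusp_forms N k \<Gamma>"
  shows "fourier_coeff N (\<lambda>z. \<alpha> * f z) m1 m2 = \<alpha> * fourier_coeff N f m1 m2"
  using fourier_coeff_lincomb[OF assms assms(2), of \<alpha> 0] by simp

section \<open>The principal congruence subgroup, acting in each variable separately\<close>

definition principal_level :: "nat \<Rightarrow> imat set" where
  "principal_level N = {A \<in> SL2Z. [A $ 1 $ 1 = 1] (mod int N) \<and> [A $ 1 $ 2 = 0] (mod int N) \<and>
     [A $ 2 $ 1 = 0] (mod int N) \<and> [A $ 2 $ 2 = 1] (mod int N)}"

lemma principal_subset_Gamma_sim:
  assumes "A \<in> principal_level N" "B \<in> principal_level N"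
  shows "(A, B) \<in> Gamma_sim N e"
proof -
  have "[e * B $ 1 $ 2 = e * 0] (mod int N)" "[e * A $ 2 $ 1 = e * 0] (mod int N)"
    using assms by (auto simp only: principal_level_def mem_Collect_eq intro: cong_mult cong_refl)
  then show ?thesis
    using assms unfolding principal_level_def Gamma_sim_def by (auto simp: cong_def)
qed

lemma mat1_in_principal: "mat 1 \<in> principal_level N"
  by (simp add: principal_level_def mat1_in_SL2Z) (simp add: mat_def)

lemma cusp_form_invariant:
  assumes "f \<in> cusp_forms N k \<Gamma>" "(A, B) \<in> \<Gamma>" "z1 \<in> upper_half" "z2 \<in> upper_half"
  shows "slash k (A, B) f (z1, z2) = f (z1, z2)"
  using cusp_formsD(3)[OF assms(1,2), of "(z1, z2)"] assms(3,4) by simp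

text \<open>The quotients of \<open>A'\<close> by \<open>A\<close> and of \<open>B'\<close> by
  \<open>B\<close>, with inverses written as adjugates, lie in \<open>principal_level N\<close> and
  leave \<open>f\<close> invariant. This lets the unspecified \<open>sigma_mat\<close> be replaced
  by a matrix chosen for convenience.\<close>

lemma slash_principal_coset:
  assumes f: "f \<in> cusp_forms N k (Gamma_sim N e)"
    and SL: "A \<in> SL2Z" "A' \<in> SL2Z" "B \<in> SL2Z" "B' \<in> SL2Z"
    and "\<And>i j. [A' $ i $ j = A $ i $ j] (mod int N)" "\<And>i j. [B' $ i $ j = B $ i $ j] (mod int N)"
    and z: "z1 \<in> upper_half" "z2 \<in> upper_half"
  shows "slash k (A', B') f (z1, z2) = slash k (A, B) f (z1, z2)"
proof -
  define adj :: "imat \<Rightarrow> imat" where "adj C = mat2 (C $ 2 $ 2) (- C $ 1 $ 2) (- C $ 2 $ 1) (C $ 1 $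
      1)" for C
  have "(C' ** adj C) ** C = C'" if "C \<in> SL2Z" for C C' :: imat
  proof -
    have "adj C ** C = mat 1"
      using that by (intro imat_eqI) (simp_all add: adj_def imat_mult_nth mat_def SL2Z_def
          det_imat algebra_simps)
    then show ?thesis by (simp add: matrix_mul_assoc[symmetric])
  qed
  moreover have "C' ** adj C \<in> principal_level N"
    if "C \<in> SL2Z" "C' \<in> SL2Z" and c: "\<And>i j. [C' $ i $ j = C $ i $ j] (mod int N)" for C C' :: imat
  proof -
    have det: "C $ 1 $ 1 * C $ 2 $ 2 - C $ 1 $ 2 * C $ 2 $ 1 = 1"
      using that(1) by (simp add: SL2Z_def det_imat)
    have "[C' $ i $ 1 * x + C' $ i $ 2 * y = C $ i $ 1 * x + C $ i $ 2 * y] (mod int N)" for i x y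
      by (intro cong_add cong_mult c cong_refl)
    then have *: "[(C' ** adj C) $ i $ j = (C ** adj C) $ i $ j] (mod int N)" for i j
      by (simp add: imat_mult_nth)
    have "C ** adj C = mat 1"
      using det by (intro imat_eqI) (simp_all add: adj_def imat_mult_nth mat_def algebra_simps)
    moreover have "det (adj C) = 1"
      using det by (simp add: adj_def algebra_simps)
    then have "det (C' ** adj C) = 1"
      using that(2) by (simp add: det_mul SL2Z_def)
    ultimately show ?thesis
      using *[of 1 1] *[of 1 2] *[of 2 1] *[of 2 2]
      by (simp add: principal_level_def SL2Z_def mat1_eq_mat2)
  qed
  ultimately have *: "(A' ** adj A, B' ** adj B) \<in> Gamma_sim N e"
    "A' = (A' ** adj A) ** A" "B' = (B' ** adj B) ** B"
    using assms by (auto intro!: principal_subset_Gamma_sim)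
  have pos: "det (A' ** adj A) > 0" "det (B' ** adj B) > 0" "det A > 0" "det B > 0"
    using *(1) SL by (auto simp: Gamma_sim_def SL2Z_def)
  have "slash k (A', B') f (z1, z2) = slash k (A, B) (slash k (A' ** adj A, B' ** adj B) f) (z1,
      z2)"
    using slash_mult[OF pos z] *(2,3) by metis
  also have "\<dots> = slash k (A, B) f (z1, z2)"
    using cusp_form_invariant[OF f *(1)] pos z by (intro slash_cong_upper_half) auto
  finally show ?thesis .
qed

lemma sigma_mat_1_in_principal: "N \<ge> 1 \<Longrightarrow> sigma_mat N 1 \<in> principal_level N"
  using sigma_mat_spec[of N 1] by (simp add: principal_level_def)

section \<open>Support of the coefficients, and Hecke operators on coefficients\<close>

lemma qpar_of_real_int_power:
  "qpar N (of_real (of_int b)) ^ m = exp (2 * of_real pi * \<i> * of_int (b * int m) / of_nat N)"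
  unfolding qpar_def exp_of_nat_mult[symmetric] by (intro arg_cong[of _ _ exp]) simp

text \<open>Translation by \<open>(t, 1)\<close> multiplies the coefficient at
  \<open>(m1, m2)\<close> by exp(2 pi i (t m1 + m2) / N). By uniqueness of the expansion this number
  is 1 wherever the coefficient is nonzero.\<close>

lemma q_expansion_support:
  assumes N: "N \<ge> 1" and g: "has_q_expansion N g c"
    and inv: "\<And>z1 z2. z1 \<in> upper_half \<Longrightarrow> z2 \<in> upper_half \<Longrightarrow> g (z1 + of_int t, z2 + 1) = g (z1, z2)"
    and "c m1 m2 \<noteq> 0"
  shows "int N dvd t * int m1 + int m2"
proof -
  have "has_q_expansion N (\<lambda>(z1, z2). g (z1 + of_real (of_int t), z2 + of_real (of_int 1)))
    (\<lambda>m1 m2. c m1 m2 * qpar N (of_real (of_int t)) ^ m1 * qpar N (of_real (of_int 1)) ^ m2)"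
    by (rule has_q_expansion_translate) fact
  then have "c = (\<lambda>m1 m2. c m1 m2 * qpar N (of_real (of_int t)) ^ m1 * qpar N (of_real (of_int 1))
      ^ m2)"
    by (rule has_q_expansion_unique[OF N g]) (use inv in simp)
  then have "c m1 m2 = c m1 m2 * qpar N (of_real (of_int t)) ^ m1 * qpar N (of_real (of_int 1)) ^
      m2"
    by metis
  then have "qpar N (of_real (of_int t)) ^ m1 * qpar N (of_real (of_int 1)) ^ m2 = 1"
    using \<open>c m1 m2 \<noteq> 0\<close> by simp
  then have "exp (2 * of_real pi * \<i> * of_int (t * int m1 + int m2) / of_nat N) = 1"
    unfolding qpar_of_real_int_power exp_add[symmetric]
    by (simp add: add_divide_distrib ring_distribs)
  then show ?thesis
    by (subst (asm) exp_two_pi_eq_1_iff) (use N in auto)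
qed

lemma cusp_form_translation_invariant:
  assumes "f \<in> cusp_forms N k (Gamma_sim N e)" "[b1 = e * b2] (mod int N)"
    and "z1 \<in> upper_half" "z2 \<in> upper_half"
  shows "f (z1 + of_int b1, z2 + of_int b2) = f (z1, z2)"
proof -
  have "(mat2 1 b1 0 1, mat2 1 b2 0 1) \<in> Gamma_sim N e"
    using assms(2) by (simp add: Gamma_sim_def SL2Z_def)
  then show ?thesis
    using cusp_form_invariant[OF assms(1) _ assms(3,4)] slash_translation by metis
qed

lemma cusp_form_support:
  assumes "N \<ge> 1" "f \<in> cusp_forms N k (Gamma_sim N e)" "fourier_coeff N f m1 m2 \<noteq> 0"
  shows "int N dvd e * int m1 + int m2"
  using assms(1) cusp_form_q_expansion(1)[OF assms(1,2)] _ assms(3)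
proof (rule q_expansion_support)
  fix z1 z2 assume "z1 \<in> upper_half" "z2 \<in> upper_half"
  then show "f (z1 + of_int e, z2 + 1) = f (z1, z2)"
    using cusp_form_translation_invariant[OF assms(2), of e 1] by simp
qed

lemma hecke_fourier_coeff:
  assumes N: "N \<ge> 1" and n: "n1 > 0" "n2 > 0" "coprime n1 N" "coprime n2 N"
    and f: "f \<in> cusp_forms N k \<Gamma>"
  shows "fourier_coeff N (hecke N k n1 n2 f) m1 m2 =
    (\<Sum>a1 | a1 dvd n1 \<and> a1 dvd m1. \<Sum>a2 | a2 dvd n2 \<and> a2 dvd m2.
      of_nat a1 powi (fst k - 1) * of_nat a2 powi (snd k - 1) *
      fourier_coeff N (slash k (sigma_mat N a1, sigma_mat N a2) f)
        (m1 div a1 * (n1 div a1)) (m2 div a2 * (n2 div a2)))"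
proof -
  have "has_q_expansion N (hecke N k n1 n2 f) (\<lambda>m1 m2.
    \<Sum>a1 | a1 dvd n1 \<and> a1 dvd m1. \<Sum>a2 | a2 dvd n2 \<and> a2 dvd m2.
      of_nat a1 powi (fst k - 1) * of_nat a2 powi (snd k - 1) *
      fourier_coeff N (slash k (sigma_mat N a1, sigma_mat N a2) f)
        (m1 div a1 * (n1 div a1)) (m2 div a2 * (n2 div a2)))"
  proof (rule hecke_q_expansion[OF N n])
    fix a1 a2 assume a: "a1 dvd n1" "a2 dvd n2"
    have "coprime a1 N" "coprime a2 N"
      using coprime_divisors[OF a(1) dvd_refl n(3)] coprime_divisors[OF a(2) dvd_refl n(4)] .
    then show "has_q_expansion N (slash k (sigma_mat N a1, sigma_mat N a2) f)
        (fourier_coeff N (slash k (sigma_mat N a1, sigma_mat N a2) f))"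
      using N f by (intro cusp_form_slash_q_expansion sigma_mat_spec)
  qed
  then show ?thesis by (simp only: fourier_coeff_eq[OF N])
qed

lemma fourier_coeff_slash_sigma_1:
  assumes "N \<ge> 1" "f \<in> cusp_forms N k (Gamma_sim N e)"
  shows "fourier_coeff N (slash k (sigma_mat N 1, sigma_mat N 1) f) = fourier_coeff N f"
proof -
  have "(sigma_mat N 1, sigma_mat N 1) \<in> Gamma_sim N e"
    using assms(1) by (intro principal_subset_Gamma_sim sigma_mat_1_in_principal)
  moreover have "has_q_expansion N (slash k (sigma_mat N 1, sigma_mat N 1) f)
      (fourier_coeff N (slash k (sigma_mat N 1, sigma_mat N 1) f))"
    using assms by (intro cusp_form_slash_q_expansion sigma_mat_spec) auto
  ultimately show ?thesis
    using assms by (intro fourier_coeff_cong cusp_form_invariant)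
qed

text \<open>Coprimality leaves only the common divisors \<open>a1 = a2 = 1\<close>. The case
  \<open>m1 = m2 = 1\<close> links the coefficients of an eigenvector to its eigenvalues.\<close>

lemma hecke_fourier_coeff_coprime:
  assumes "N \<ge> 1" and "n1 > 0" "n2 > 0" "coprime n1 N" "coprime n2 N"
    and "f \<in> cusp_forms N k (Gamma_sim N e)" "coprime n1 m1" "coprime n2 m2"
  shows "fourier_coeff N (hecke N k n1 n2 f) m1 m2 = fourier_coeff N f (m1 * n1) (m2 * n2)"
proof -
  have "{a. a dvd n1 \<and> a dvd m1} = {1}" "{a. a dvd n2 \<and> a dvd m2} = {1}"
    using assms(7,8) coprime_common_divisor_nat by auto
  then show ?thesis
    using hecke_fourier_coeff[OF assms(1-6), of m1 m2] fourier_coeff_slash_sigma_1[OF assms(1,6)]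
    by simp
qed

text \<open>The common divisors of \<open>p\<close> and \<open>p * m1\<close> are 1 and
  \<open>p\<close>. The second one brings in a diamond operator in the first variable, whose
  coefficients are needed to treat the square of \<open>p\<close>.\<close>

lemma hecke_fourier_coeff_prime:
  assumes "N \<ge> 1" "prime p" "coprime p N" and "f \<in> cusp_forms N k (Gamma_sim N e)"
  shows "fourier_coeff N (hecke N k p 1 f) (p * m1) m2 = fourier_coeff N f (p * m1 * p) m2 +
    of_nat p powi (fst k - 1) * fourier_coeff N (slash k (sigma_mat N p, sigma_mat N 1) f) m1 m2"
proof -
  have p: "p > 0" "p \<noteq> 1" using assms(2) prime_gt_0_nat by auto
  have "{a. a dvd p \<and> a dvd p * m1} = {1, p}" "{a. a dvd (1 :: nat) \<and> a dvd m2} = {1}"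
    using assms(2) by (auto simp: prime_nat_iff)
  then show ?thesis
    using hecke_fourier_coeff[OF assms(1) p(1) _ assms(3) _ assms(4), of 1 "p * m1" m2]
      fourier_coeff_slash_sigma_1[OF assms(1,4)] p by simp
qed


subsection \<open>Diamond operators\<close>

text \<open>Multiplication by the unit \<open>s\<close> permutes the residue classes modulo
  \<open>L\<close>.\<close>

lemma sum_periodic_unit_multiple:
  fixes \<Psi> :: "int \<Rightarrow> 'a :: comm_monoid_add"
  assumes "L > 0" "coprime s (int L)" and per: "\<And>i j. [i = j] (mod int L) \<Longrightarrow> \<Psi> i = \<Psi> j"
  shows "(\<Sum>b<L. \<Psi> (s * int b)) = (\<Sum>b<L. \<Psi> (int b))"
proof -
  define h where "h b = nat (s * int b mod int L)" for b
  have h: "int (h b) = s * int b mod int L" for b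
    using assms(1) by (simp add: h_def)
  have sub: "h ` {..<L} \<subseteq> {..<L}"
    using assms(1) h by (auto simp: h_def nat_less_iff)
  have inj: "inj_on h {..<L}"
  proof (rule inj_onI)
    fix x y assume xy: "x \<in> {..<L}" "y \<in> {..<L}" "h x = h y"
    then have "[s * int x = s * int y] (mod int L)"
      unfolding cong_def using h by metis
    then have "[int x = int y] (mod int L)"
      using assms(2) cong_mult_lcancel by blast
    then show "x = y" using xy by (simp add: cong_def)
  qed
  have "h ` {..<L} = {..<L}"
    using endo_inj_surj[OF _ sub inj] by simp
  then have "(\<Sum>b<L. \<Psi> (int b)) = (\<Sum>b<L. \<Psi> (int (h b)))"
    using inj by (metis (no_types, lifting) sum.reindex_cong)
  also have "\<dots> = (\<Sum>b<L. \<Psi> (s * int b))"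
    by (intro sum.cong refl per) (simp add: h cong_def)
  finally show ?thesis ..
qed

text \<open>Orthogonality of characters modulo \<open>p * N\<close>: a shift by \<open>b / p\<close>
  multiplies the term of exponent \<open>m1\<close> by exp(2 pi i b m1 / (p N)), so the weighted sum
  over \<open>b\<close> singles out the \<open>m1\<close> congruent to \<open>v\<close>.\<close>

lemma q_expansion_residue_projection:
  assumes N: "N \<ge> 1" and p: "p > 0" and g: "has_q_expansion N g c"
  shows "has_q_expansion N
    (\<lambda>(z1, z2). \<Sum>b<p * N. exp (2 * of_real pi * \<i> * of_int (- (v * int b)) / of_nat (p * N)) *
       g (z1 + of_int (int b) / of_nat p, z2))
    (\<lambda>m1 m2. if int (p * N) dvd int m1 - v then of_nat (p * N) * c m1 m2 else 0)"
proof -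
  define e :: "int \<Rightarrow> complex" where "e j = exp (2 * of_real pi * \<i> * of_int j / of_nat (p * N))"
      for j
  have pN: "p * N > 0" using N p by simp
  have "has_q_expansion N (\<lambda>z. \<Sum>b<p * N. e (- (v * int b)) *
      (\<lambda>(z1, z2). g (z1 + of_real (real b / real p), z2 + of_real 0)) z)
    (\<lambda>m1 m2. \<Sum>b<p * N. e (- (v * int b)) *
      (c m1 m2 * qpar N (of_real (real b / real p)) ^ m1 * qpar N (of_real 0) ^ m2))"
    by (intro has_q_expansion_sum has_q_expansion_scale has_q_expansion_translate g) simp
  moreover have "(\<Sum>b<p * N. e (- (v * int b)) *
      (c m1 m2 * qpar N (of_real (real b / real p)) ^ m1 * qpar N (of_real 0) ^ m2)) =
    (if int (p * N) dvd int m1 - v then of_nat (p * N) * c m1 m2 else 0)" for m1 m2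
  proof -
    have "e (- (v * int b)) * qpar N (of_real (real b / real p)) ^ m1 = e (int m1 - v) ^ b" for b
      unfolding e_def qpar_def exp_of_nat_mult[symmetric] exp_add[symmetric]
      using p N by (intro arg_cong[of _ _ exp]) (simp add: field_simps)
    then have "(\<Sum>b<p * N. e (- (v * int b)) *
      (c m1 m2 * qpar N (of_real (real b / real p)) ^ m1 * qpar N (of_real 0) ^ m2)) =
      c m1 m2 * (\<Sum>b<p * N. e (int m1 - v) ^ b)"
      unfolding sum_distrib_left by (intro sum.cong refl) (simp add: qpar_def mult_ac)
    also have "(\<Sum>b<p * N. e (int m1 - v) ^ b) = (if int (p * N) dvd int m1 - v then of_nat (p * N)
        else 0)"
      unfolding e_def by (rule sum_roots_of_unity[OF pN])
    finally show ?thesis by (simp add: mult.commute)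
  qed
  ultimately show ?thesis
    unfolding e_def by (simp add: case_prod_unfold)
qed

text \<open>
  For \<open>s = (\<alpha>, \<beta>; \<gamma>, \<delta>)\<close> with \<open>\<gamma> = p\<^sup>2N\<close> and \<open>x = b/p\<close>, the matrix \<open>s T(x) s\<^sup>-\<^sup>1 T(- \<alpha>\<^sup>2x)\<close>, where
  \<open>T(y)\<close> is the shift by \<open>y\<close>, is integral and lies in \<open>\<Gamma>(N)\<close>; it is the matrix \<open>G\<close> in the proof.
\<close>

lemma slash_fractional_shift:
  fixes p :: nat and \<alpha> \<beta> \<delta> b :: int
  assumes N: "N \<ge> 1" and p: "p > 0" and f: "f \<in> cusp_forms N k (Gamma_sim N e)"
    and s: "s = mat2 \<alpha> \<beta> (int p ^ 2 * int N) \<delta>" and det: "\<alpha> * \<delta> - \<beta> * (int p ^ 2 * int N) = 1"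
    and z: "z1 \<in> upper_half" "z2 \<in> upper_half"
  shows "slash k (s, mat 1) f (z1 + of_int b / of_nat p, z2) =
    f (moeb s z1 + of_int (\<alpha>\<^sup>2 * b) / of_nat p, z2) *
    (of_int (int p ^ 2 * int N) * z1 + of_int \<delta>) powi (- fst k)"
proof -
  \<comment> \<open>With \<gamma> the lower left entry of \<open>s\<close> and x = b/p, both
    \<gamma> x = p N b and \<gamma> x^2 = N b^2 are multiples of \<open>N\<close>. The one entry of
    s T(x) s^-1 that may be fractional is \<alpha>^2 x at the upper right, and the shift by -
    \<alpha>^2 x removes it.\<close>
  define G where "G = mat2 (1 - \<alpha> * int p * int N * b) (\<alpha> ^ 3 * b\<^sup>2 * int N) (- (int p ^ 3 * int N
      ^ 2 * b))
    (1 + \<alpha> * int p * int N * b + (\<alpha> * int p * int N * b)\<^sup>2)"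
  have detG: "det G = 1"
    unfolding G_def det_mat2 by (simp add: power2_eq_square power3_eq_cube algebra_simps)
  have G: "G \<in> principal_level N"
    using detG by (simp add: principal_level_def SL2Z_def)
      (simp add: G_def cong_iff_dvd_diff power2_eq_square algebra_simps)
  have dets: "det s = 1" using det by (simp add: s)
  define x :: complex where "x = of_int b / of_nat p"
  have px: "of_int b = of_nat p * x" using p by (simp add: x_def)
  define A B D :: complex where "A = of_int \<alpha>" and "B = of_int \<beta>" and "D = of_int \<delta>"
  define C :: complex where "C = of_nat p ^ 2 * of_nat N"
  have "complex_of_int (\<alpha> * \<delta> - \<beta> * (int p ^ 2 * int N)) = 1" unfolding det by simp
  then have ADBC: "A * D = 1 + B * C" by (simp add: A_def B_def C_def D_def algebra_simps)
  define u where "u = C * z1 + D"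
  define Z where "Z = moeb s z1"
  define w where "w = Z + A\<^sup>2 * x"
  have u: "u \<noteq> 0" "Z * u = A * z1 + B"
    using denom_nonzero[of s z1] moeb_times_denom[of s z1] z dets
    by (simp_all add: s u_def Z_def A_def B_def C_def D_def)
  have Z: "Z \<in> upper_half" using moeb_upper_half[of s z1] dets z by (simp add: Z_def)
  have real_x: "x = of_real (of_int b / of_nat p)" by (simp add: x_def)
  have "Im x = 0" "Im (A\<^sup>2 * x) = 0"
    unfolding real_x A_def by (simp_all del: of_real_divide add: power2_eq_square)
  then have w: "w \<in> upper_half" and zx: "z1 + x \<in> upper_half"
    using Z z by (simp_all add: w_def upper_half_def del: times_complex.simps)
  define J where "J = of_int (G $ 2 $ 1) * w + of_int (G $ 2 $ 2)"
  have J0: "J \<noteq> 0" using denom_nonzero[of G w] detG w by (simp add: J_def)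
  have G21: "of_int (G $ 2 $ 1) = - (C\<^sup>2 * x)" and G22: "of_int (G $ 2 $ 2) = 1 + A * C * x + (A *
      C * x)\<^sup>2"
    and G11: "of_int (G $ 1 $ 1) = 1 - A * C * x" and G12: "of_int (G $ 1 $ 2) = A ^ 3 * C * x\<^sup>2"
    by (simp_all add: G_def px A_def C_def power2_eq_square power3_eq_cube mult_ac)
  \<comment> \<open>Shifts by fractions are not integral matrices, so the identity G T(\<alpha>^2 x)
    s = s T(x) is verified at the point \<open>z1\<close>: here for the denominators, next for the
    numerators.\<close>
  have Ju: "J * u = C * (z1 + x) + D"
  proof -
    have "J * u = - (C\<^sup>2 * x) * (Z * u) + (1 + A * C * x) * u"
      unfolding J_def G21 G22 w_def by (simp add: power2_eq_square algebra_simps)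
    also have "\<dots> = u + C * x * (A * D - B * C)"
      unfolding u(2) by (simp add: u_def power2_eq_square algebra_simps)
    finally show ?thesis unfolding ADBC by (simp add: u_def algebra_simps)
  qed
  have "moeb G w * (J * u) = (of_int (G $ 1 $ 1) * w + of_int (G $ 1 $ 2)) * u"
    using moeb_times_denom[of G w] detG w by (simp add: J_def mult.assoc[symmetric])
  also have "\<dots> = (1 - A * C * x) * (Z * u) + A\<^sup>2 * x * u"
    unfolding G11 G12 w_def by (simp add: power2_eq_square power3_eq_cube algebra_simps)
  also have "\<dots> = A * z1 + B + A * x * (A * D - B * C)"
    unfolding u(2) by (simp add: u_def power2_eq_square algebra_simps)
  also have "\<dots> = A * (z1 + x) + B"
    unfolding ADBC by (simp add: algebra_simps)
  also have "\<dots> = moeb s (z1 + x) * (J * u)"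
    using moeb_times_denom[of s "z1 + x"] dets zx unfolding Ju
    by (simp add: s A_def B_def C_def D_def)
  finally have moeb_eq: "moeb G w = moeb s (z1 + x)"
    using J0 u(1) by simp
  have "slash k (G, mat 1) f (w, z2) = f (w, z2)"
    by (rule cusp_form_invariant[OF f principal_subset_Gamma_sim[OF G mat1_in_principal] w z(2)])
  then have inv: "f (moeb G w, z2) * J powi (- fst k) = f (w, z2)"
    using detG by (simp add: slash_def aut_factor_def J_def moeb_upper_triangular mat1_eq_mat2)
  have "slash k (s, mat 1) f (z1 + x, z2) = f (moeb s (z1 + x), z2) * (C * (z1 + x) + D) powi (-
      fst k)"
    using dets by (simp add: slash_def aut_factor_def moeb_upper_triangular mat1_eq_mat2)
      (simp add: s C_def D_def)
  also have "\<dots> = f (w, z2) * u powi (- fst k)"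
    unfolding Ju[symmetric] moeb_eq[symmetric] inv[symmetric] by (simp add: power_int_mult_distrib)
  finally show ?thesis
    by (simp add: x_def w_def Z_def u_def A_def C_def D_def)
qed

text \<open>The lower right entry \<open>p + N\<close> is congruent to \<open>p\<close> modulo
  \<open>N\<close> and also coprime to \<open>p\<close>, as the lower left entry p^2 N requires.
  Inverting it modulo p^2 N^2 makes \<open>\<beta>\<close> a multiple of \<open>N\<close>.\<close>

lemma diamond_representative:
  assumes "N \<ge> 1" "p > 0" "coprime p N"
  obtains \<alpha> \<beta> where "\<alpha> * (int p + int N) - \<beta> * (int p ^ 2 * int N) = 1"
    "[\<alpha> * int p = 1] (mod int N)" "[\<beta> = 0] (mod int N)" "coprime \<alpha> (int (p * N))"
proof -
  define \<delta> where "\<delta> = int p + int N"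
  have "coprime (int p) (int N)" using assms(3) by simp
  then have "coprime \<delta> (int p)" "coprime \<delta> (int N)"
    unfolding \<delta>_def coprime_iff_gcd_eq_1
    by (metis add.commute gcd.commute gcd_add1, metis gcd_add1)
  then have "coprime \<delta> (int p ^ 2 * int N * int N)" by simp
  then obtain x where "[\<delta> * x = 1] (mod (int p ^ 2 * int N * int N))"
    using cong_solve_coprime_int by blast
  then obtain t where t: "\<delta> * x - 1 = int p ^ 2 * int N * int N * t"
    unfolding cong_iff_dvd_diff by (auto elim: dvdE)
  have 1: "x * \<delta> - (int N * t) * (int p ^ 2 * int N) = 1"
    using t by (simp add: algebra_simps)
  have "x * int p - 1 = int N * (int p ^ 2 * int N * t - x)"
    using t by (simp add: \<delta>_def algebra_simps)
  then have 2: "[x * int p = 1] (mod int N)"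
    unfolding cong_iff_dvd_diff by simp
  have "coprime x (int (p * N))"
  proof (rule coprimeI)
    fix d assume d: "d dvd x" "d dvd int (p * N)"
    have "x * \<delta> - int (p * N) * (int N * t * int p) = 1"
      using 1 by (simp add: power2_eq_square algebra_simps)
    then show "is_unit d" using d by (metis dvd_diff dvd_mult2)
  qed
  then show ?thesis
    using that[of x "int N * t"] 1 2 by (simp add: \<delta>_def cong_iff_dvd_diff)
qed

text \<open>Slashing with the diamond matrix turns the shift by b/p into the shift by \<alpha>^2
  b/p. So the part of the slashed form with \<open>m1\<close> in the class of \<alpha>^2 modulo p N
  corresponds to the part of \<open>f\<close> with \<open>m1\<close> in the class of 1, and the
  hypothesis kills the former.\<close>

lemma diamond_coeff_injective:
  assumes N: "N \<ge> 1" and p: "prime p" "coprime p N" and e: "coprime e (int N)"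
    and f: "f \<in> cusp_forms N k (Gamma_sim N e)"
    and zero: "\<And>m1 m2. coprime m1 (p * N) \<Longrightarrow> coprime m2 N \<Longrightarrow>
      fourier_coeff N (slash k (sigma_mat N p, sigma_mat N 1) f) m1 m2 = 0"
  shows "fourier_coeff N f 1 1 = 0"
proof -
  have p0: "p > 0" using p(1) prime_gt_0_nat by blast
  define L where "L = p * N"
  have L: "L > 0" using N p0 by (simp add: L_def)
  define \<gamma> \<delta> where "\<gamma> = int p ^ 2 * int N" and "\<delta> = int p + int N"
  obtain \<alpha> \<beta> where det: "\<alpha> * \<delta> - \<beta> * \<gamma> = 1" and \<alpha>: "[\<alpha> * int p = 1] (mod int N)"
    and \<beta>: "[\<beta> = 0] (mod int N)" and coL: "coprime \<alpha> (int L)"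
    using diamond_representative[OF N p0 p(2)] unfolding \<gamma>_def \<delta>_def L_def by metis
  define s where "s = mat2 \<alpha> \<beta> \<gamma> \<delta>"
  have s: "s \<in> SL2Z" using det by (simp add: s_def SL2Z_def)
  define h where "h = slash k (s, mat 1) f"
  note sig = sigma_mat_spec[OF N p(2)]
  have cop: "coprime (int p) (int N)" using p(2) by simp
  \<comment> \<open>The explicit \<open>s\<close> may replace \<open>sigma_mat N p\<close> because
    they agree modulo \<open>N\<close>.\<close>
  have "[s $ i $ j = sigma_mat N p $ i $ j] (mod int N)" for i j
  proof -
    have "[\<alpha> * int p = sigma_mat N p $ 1 $ 1 * int p] (mod int N)"
      using \<alpha> sig(2) by (simp add: cong_def)
    then have "[\<alpha> = sigma_mat N p $ 1 $ 1] (mod int N)"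
      using cong_mult_rcancel[OF cop] by simp
    moreover have "[\<delta> = sigma_mat N p $ 2 $ 2] (mod int N)" "[\<gamma> = sigma_mat N p $ 2 $ 1] (mod int
        N)"
      "[\<beta> = sigma_mat N p $ 1 $ 2] (mod int N)"
      using sig(3,4,5) \<beta> by (simp_all add: cong_def \<delta>_def \<gamma>_def)
    ultimately have "\<forall>i j. [s $ i $ j = sigma_mat N p $ i $ j] (mod int N)"
      unfolding forall_2 by (simp add: s_def)
    then show ?thesis by blast
  qed
  moreover have "[(mat 1 :: imat) $ i $ j = sigma_mat N 1 $ i $ j] (mod int N)" for i j
  proof -
    have "\<forall>i j. [(mat 1 :: imat) $ i $ j = sigma_mat N 1 $ i $ j] (mod int N)"
      using sigma_mat_1_in_principal[OF N] unfolding forall_2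
      by (simp add: mat1_eq_mat2 principal_level_def cong_sym_eq)
    then show ?thesis by blast
  qed
  ultimately have "h (z1, z2) = slash k (sigma_mat N p, sigma_mat N 1) f (z1, z2)"
    if "z1 \<in> upper_half" "z2 \<in> upper_half" for z1 z2
    unfolding h_def using that s sig(1) sigma_mat_1_in_principal[OF N]
    by (intro slash_principal_coset[OF f] mat1_in_SL2Z) (auto simp: principal_level_def)
  moreover have hq: "has_q_expansion N h (fourier_coeff N h)"
    unfolding h_def by (rule cusp_form_slash_q_expansion[OF N f s mat1_in_SL2Z])
  ultimately have fc: "fourier_coeff N h = fourier_coeff N (slash k (sigma_mat N p, sigma_mat N 1)
      f)"
    by (intro fourier_coeff_cong[OF N hq])
  define J where "J z1 = (of_int \<gamma> * z1 + of_int \<delta> :: complex) powi (- fst k)" for z1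
  have shift: "h (z1 + of_int b / of_nat p, z2) = f (moeb s z1 + of_int (\<alpha>\<^sup>2 * b) / of_nat p, z2)
      * J z1"
    if "z1 \<in> upper_half" "z2 \<in> upper_half" for z1 z2 b
    unfolding h_def J_def \<gamma>_def
    by (rule slash_fractional_shift[OF N p0 f s_def[unfolded \<gamma>_def] det[unfolded \<gamma>_def] that])
  have dets: "det s > 0" using s by (simp add: SL2Z_def)
  have "[\<alpha> * \<delta> = \<alpha> * int p] (mod int N)" by (simp add: \<delta>_def cong_iff_dvd_diff algebra_simps)
  then have \<alpha>\<delta>: "[\<alpha> * \<delta> = 1] (mod int N)" using \<alpha> cong_trans by blast
  \<comment> \<open>An integral shift t of \<open>h\<close> in the first variable shifts
    \<open>f\<close> by \<alpha>^2 t. As \<open>\<alpha> * \<delta>\<close> is 1 modulo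
    \<open>N\<close>, the choice t = e \<delta>^2 makes this \<open>e\<close> modulo
    \<open>N\<close>, which matches the shift 1 in the second variable.\<close>
  have hsupp: "int N dvd (e * \<delta>\<^sup>2) * int m1 + int m2" if "fourier_coeff N h m1 m2 \<noteq> 0" for m1 m2
  proof (rule q_expansion_support[OF N hq _ that])
    fix z1 z2 assume z: "z1 \<in> upper_half" "z2 \<in> upper_half"
    then have z': "z2 + 1 \<in> upper_half" "moeb s z1 \<in> upper_half"
      using moeb_upper_half[OF dets] by (auto simp: upper_half_def)
    have "[e * (\<alpha> * \<delta>)\<^sup>2 = e * 1\<^sup>2] (mod int N)"
      by (intro cong_mult cong_refl cong_pow \<alpha>\<delta>)
    then have "[\<alpha>\<^sup>2 * (e * \<delta>\<^sup>2) = e * 1] (mod int N)"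
      by (simp add: power_mult_distrib mult_ac)
    then have inv: "f (moeb s z1 + of_int (\<alpha>\<^sup>2 * (e * \<delta>\<^sup>2)), z2 + of_int 1) = f (moeb s z1, z2)"
      by (rule cusp_form_translation_invariant[OF f _ z'(2) z(2)])
    have "h (z1 + of_int (int p * (e * \<delta>\<^sup>2)) / of_nat p, z2 + 1) =
        f (moeb s z1 + of_int (\<alpha>\<^sup>2 * (int p * (e * \<delta>\<^sup>2))) / of_nat p, z2 + 1) * J z1"
      by (rule shift) fact+
    also have "\<dots> = f (moeb s z1, z2) * J z1"
      using inv p0 by simp
    also have "\<dots> = h (z1, z2)"
      using shift[OF z, of 0] by simp
    finally show "h (z1 + of_int (e * \<delta>\<^sup>2), z2 + 1) = h (z1, z2)"
      using p0 by simp
  qed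
  \<comment> \<open>An exponent \<open>m1\<close> congruent to \<alpha>^2 is coprime to
    \<open>p * N\<close>; at a nonzero coefficient the support condition then makes
    \<open>m2\<close> coprime to \<open>N\<close>, so \<open>zero\<close> applies.\<close>
  have hzero: "fourier_coeff N h m1 m2 = 0" if m1: "int L dvd int m1 - \<alpha>\<^sup>2" for m1 m2
  proof (rule ccontr)
    assume nz: "fourier_coeff N h m1 m2 \<noteq> 0"
    have "[\<alpha>\<^sup>2 = int m1] (mod int L)"
      using m1 by (simp add: cong_iff_dvd_diff dvd_diff_commute)
    moreover have "coprime (\<alpha>\<^sup>2) (int L)" using coL by simp
    ultimately have "coprime (int m1) (int L)" using cong_imp_coprime by blast
    then have m1L: "coprime m1 (p * N)" and m1N: "coprime (int m1) (int N)" by (auto simp: L_def)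
    have "coprime \<delta> (int N)"
      using \<alpha>\<delta> by (metis cong_imp_coprime cong_sym coprime_1_left coprime_mult_left_iff)
    then have "coprime ((e * \<delta>\<^sup>2) * int m1) (int N)" using e m1N by simp
    moreover have "[- ((e * \<delta>\<^sup>2) * int m1) = int m2] (mod int N)"
      using hsupp[OF nz] by (simp add: cong_iff_dvd_diff) (metis dvd_minus_iff minus_diff_eq
          diff_minus_eq_add add.commute)
    ultimately have "coprime (int m2) (int N)"
      using cong_imp_coprime coprime_minus_left_iff by blast
    then show False using zero[OF m1L, of m2] nz fc by simp
  qed
  define E :: "int \<Rightarrow> complex" where "E j = exp (2 * of_real pi * \<i> * of_int j / of_nat L)" for j
  define P where "P v g = (\<lambda>(z1, z2). \<Sum>b<L. E (- (v * int b)) * g (z1 + of_int (int b) / of_nat p,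
      z2))"
    for v and g :: fun2
  have P_exp: "has_q_expansion N (P v g) (\<lambda>m1 m2. if int L dvd int m1 - v then of_nat L * c m1 m2
      else 0)"
    if "has_q_expansion N g c" for v g c
    unfolding P_def E_def L_def by (rule q_expansion_residue_projection[OF N p0 that])
  have Ph: "P (\<alpha>\<^sup>2) h (z1, z2) = 0" if z: "z1 \<in> upper_half" "z2 \<in> upper_half" for z1 z2
  proof -
    have "has_q_expansion N (P (\<alpha>\<^sup>2) h) (\<lambda>_ _. 0)"
      using P_exp[OF hq, of "\<alpha>\<^sup>2"] hzero by (simp cong: if_cong)
    then have "((\<lambda>_ :: nat \<times> nat. 0) has_sum P (\<alpha>\<^sup>2) h (z1, z2)) UNIV"
      using z by (simp add: has_q_expansion_def case_prod_unfold)
    then show ?thesis using has_sum_unique has_sum_0_simp by blast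
  qed
  \<comment> \<open>Writing \<open>Z\<close> as \<open>moeb s z1\<close>, the projection of
    \<open>h\<close> at \<open>z1\<close> is the corresponding sum for \<open>f\<close> at
    \<open>Z\<close> along the shifts \<alpha>^2 b/p, times the nonzero factor
    \<open>J z1\<close>.\<close>
  have "P 1 f (Z, z2) = 0" if Z: "Z \<in> upper_half" and z2: "z2 \<in> upper_half" for Z z2
  proof -
    define s' where "s' = mat2 \<delta> (- \<beta>) (- \<gamma>) \<alpha>"
    have dets': "det s' > 0" using det by (simp add: s'_def algebra_simps)
    define z1 where "z1 = moeb s' Z"
    have z1: "z1 \<in> upper_half" unfolding z1_def by (rule moeb_upper_half[OF dets' Z])
    have "s ** s' = mat 1"
      using det by (intro imat_eqI) (simp_all add: imat_mult_nth s_def s'_def mat1_eq_mat2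
          algebra_simps)
    then have "moeb s z1 = moeb (mat 1) Z"
      unfolding z1_def using moeb_mult[OF dets dets' Z] by simp
    then have sz: "moeb s z1 = Z" by (simp add: mat1_eq_mat2 moeb_def)
    \<comment> \<open>This has period \<open>L\<close> in \<open>j\<close>: the exponential does,
      and adding \<open>L * t\<close> to \<open>j\<close> shifts the argument of \<open>f\<close> by
      \<open>N * t\<close>, which changes nothing. So \<alpha>^2 b may be replaced by b.\<close>
    define \<Psi> where "\<Psi> j = E (- j) * f (Z + of_int j / of_nat p, z2)" for j
    have "(\<Sum>b<L. \<Psi> (\<alpha>\<^sup>2 * int b)) = (\<Sum>b<L. \<Psi> (int b))"
    proof (rule sum_periodic_unit_multiple[OF L])
      show "coprime (\<alpha>\<^sup>2) (int L)" using coL by simp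
      fix i j assume "[i = j] (mod int L)"
      then obtain t where t: "i = j + int L * t"
        by (metis cong_iff_lin cong_sym mult.commute)
      have "E (int L * t) = 1"
        unfolding E_def by (subst exp_two_pi_eq_1_iff[OF L]) simp
      moreover have "E (- i) * E (int L * t) = E (- j)"
        unfolding E_def exp_add[symmetric] t using L by (intro arg_cong[of _ _ exp]) (simp add:
            field_simps)
      moreover have "f (Z + of_int i / of_nat p, z2) = f (Z + of_int j / of_nat p, z2)"
      proof -
        have "Z + of_real (of_int j / of_nat p) \<in> upper_half"
          using Z by (simp add: upper_half_def del: of_real_divide)
        then have "Z + of_int j / of_nat p \<in> upper_half" by simp
        moreover have "of_int i / of_nat p = of_int j / of_nat p + (of_int (int N * t) :: complex)"
          using p0 by (simp add: t L_def field_simps)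
        ultimately show ?thesis
          using cusp_form_translation_invariant[OF f, of "int N * t" 0 "Z + of_int j / of_nat p"
              z2] z2
          by (simp add: cong_iff_dvd_diff add.assoc)
      qed
      ultimately show "\<Psi> i = \<Psi> j" by (simp add: \<Psi>_def)
    qed
    then have "(\<Sum>b<L. \<Psi> (\<alpha>\<^sup>2 * int b)) * J z1 = P 1 f (Z, z2) * J z1"
      by (simp add: P_def \<Psi>_def)
    moreover have "(\<Sum>b<L. \<Psi> (\<alpha>\<^sup>2 * int b)) * J z1 = P (\<alpha>\<^sup>2) h (z1, z2)"
      unfolding P_def prod.case shift[OF z1 z2] sum_distrib_right \<Psi>_def sz
      by (simp add: mult.assoc)
    moreover have "J z1 \<noteq> 0"
      using denom_nonzero[OF dets z1] by (simp add: J_def s_def)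
    ultimately show ?thesis using Ph[OF z1 z2] by simp
  qed
  then have "(if int L dvd int 1 - 1 then of_nat L * fourier_coeff N f 1 1 else 0) = 0"
    by (rule has_q_expansion_zero_unique[OF N P_exp[OF cusp_form_q_expansion(1)[OF N f], of 1]])
  then show ?thesis using L by simp
qed


subsection \<open>The quotient spaces\<close>

context
  fixes N :: nat
  assumes N: "N \<ge> 1"
begin

text \<open>Linearity turns the condition on the difference into an equality of coefficients, the
  form in which classes are compared from here on.\<close>

lemma null_rel_iff:
  "(f, g) \<in> null_rel N k e \<longleftrightarrow>
     f \<in> cusp_forms N k (Gamma_sim N e) \<and> g \<in> cusp_forms N k (Gamma_sim N e) \<and>
     (\<forall>m1 m2. coprime m1 N \<and> coprime m2 N \<longrightarrow> fourier_coeff N f m1 m2 = fourier_coeff N g m1 m2)"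
proof -
  have "(\<lambda>z. f z - g z) \<in> cusp_forms N k (Gamma_sim N e)"
    "fourier_coeff N (\<lambda>z. f z - g z) m1 m2 = fourier_coeff N f m1 m2 - fourier_coeff N g m1 m2"
    if "f \<in> cusp_forms N k (Gamma_sim N e)" "g \<in> cusp_forms N k (Gamma_sim N e)" for m1 m2
    using cusp_forms_lincomb[OF that, of 1 "-1"] fourier_coeff_lincomb[OF N that, of 1 "-1"] by
        simp_all
  then show ?thesis
    unfolding null_rel_def null_forms_def by auto
qed

lemma equiv_null_rel: "equiv (cusp_forms N k (Gamma_sim N e)) (null_rel N k e)"
  by (rule equivI) (auto simp: refl_on_def sym_def trans_def null_rel_iff)

lemma Sbar_eq_class:
  assumes "X \<in> Sbar N k e" "\<phi> \<in> X"
  shows "\<phi> \<in> cusp_forms N k (Gamma_sim N e)" "X = Sbar_class N k e \<phi>"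
proof -
  show "\<phi> \<in> cusp_forms N k (Gamma_sim N e)"
    using assms equiv_null_rel in_quotient_imp_subset unfolding Sbar_def by blast
  show "X = Sbar_class N k e \<phi>"
  proof -
    obtain \<psi> where \<psi>: "X = null_rel N k e `` {\<psi>}"
      using assms(1) unfolding Sbar_def by (rule quotientE)
    then have "(\<psi>, \<phi>) \<in> null_rel N k e" using assms(2) by simp
    then show ?thesis
      unfolding Sbar_class_def \<psi> by (rule equiv_class_eq[OF equiv_null_rel])
  qed
qed

lemma Sbar_class_in_Sbar:
  "\<phi> \<in> cusp_forms N k (Gamma_sim N e) \<Longrightarrow> Sbar_class N k e \<phi> \<in> Sbar N k e"
  unfolding Sbar_def Sbar_class_def by (rule quotientI)

lemma rep_in_Sbar_class:
  "\<phi> \<in> cusp_forms N k (Gamma_sim N e) \<Longrightarrow> \<phi> \<in> Sbar_class N k e \<phi>"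
  unfolding Sbar_class_def using equiv_null_rel equiv_class_self by fastforce

lemma Sbar_class_nonemptyD:
  "\<psi> \<in> Sbar_class N k e \<phi> \<Longrightarrow> \<phi> \<in> cusp_forms N k (Gamma_sim N e)"
  by (auto simp: Sbar_class_def null_rel_iff)

lemma Sbar_nonempty: "X \<in> Sbar N k e \<Longrightarrow> \<exists>\<phi>. \<phi> \<in> X"
  using equiv_null_rel in_quotient_imp_non_empty unfolding Sbar_def by blast

lemma Sbar_class_eq_iff:
  assumes "\<phi> \<in> cusp_forms N k (Gamma_sim N e)" "\<psi> \<in> cusp_forms N k (Gamma_sim N e)"
  shows "Sbar_class N k e \<phi> = Sbar_class N k e \<psi> \<longleftrightarrow>
    (\<forall>m1 m2. coprime m1 N \<and> coprime m2 N \<longrightarrow> fourier_coeff N \<phi> m1 m2 = fourier_coeff N \<psi> m1 m2)"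
  using assms eq_equiv_class_iff[OF equiv_null_rel assms] unfolding Sbar_class_def null_rel_iff by
      blast

lemma Sbar_eq_iff:
  assumes "X \<in> Sbar N k e" "Y \<in> Sbar N k e" "\<phi> \<in> X" "\<psi> \<in> Y"
  shows "X = Y \<longleftrightarrow>
    (\<forall>m1 m2. coprime m1 N \<and> coprime m2 N \<longrightarrow> fourier_coeff N \<phi> m1 m2 = fourier_coeff N \<psi> m1 m2)"
  using Sbar_eq_class[OF assms(1,3)] Sbar_eq_class[OF assms(2,4)] Sbar_class_eq_iff by metis

lemma Sbar_coeff_unique:
  assumes "X \<in> Sbar N k e" "\<phi> \<in> X" "\<psi> \<in> X" "coprime m1 N" "coprime m2 N"
  shows "fourier_coeff N \<phi> m1 m2 = fourier_coeff N \<psi> m1 m2"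
  using Sbar_eq_iff[OF assms(1,1,2,3)] assms(4,5) by blast

lemma Sbar_zero_in_Sbar: "Sbar_zero N k e \<in> Sbar N k e"
  unfolding Sbar_zero_def by (intro Sbar_class_in_Sbar cusp_forms_zero)

lemma zero_in_Sbar_zero: "(\<lambda>_. 0) \<in> Sbar_zero N k e"
  unfolding Sbar_zero_def by (intro rep_in_Sbar_class cusp_forms_zero)

lemma Sbar_eq_zero_iff:
  assumes "X \<in> Sbar N k e" "\<phi> \<in> X"
  shows "X = Sbar_zero N k e \<longleftrightarrow>
    (\<forall>m1 m2. coprime m1 N \<and> coprime m2 N \<longrightarrow> fourier_coeff N \<phi> m1 m2 = 0)"
proof -
  have "fourier_coeff N (\<lambda>_. 0) m1 m2 = 0" for m1 m2
    using fourier_coeff_scale[OF N cusp_forms_zero, of 0] by simp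
  then show ?thesis
    using Sbar_eq_iff[OF assms(1) Sbar_zero_in_Sbar assms(2) zero_in_Sbar_zero] by simp
qed

text \<open>All members of \<open>X\<close> share their coefficients at indices coprime to
  \<open>N\<close>, so the union in \<open>Sbar_scale\<close> is a union of equal classes.\<close>

lemma Sbar_scale_eq_class:
  assumes "X \<in> Sbar N k e" "\<phi> \<in> X"
  shows "Sbar_scale N k e c X = Sbar_class N k e (\<lambda>z. c * \<phi> z)"
proof -
  have "Sbar_class N k e (\<lambda>z. c * \<psi> z) = Sbar_class N k e (\<lambda>z. c * \<phi> z)" if "\<psi> \<in> X" for \<psi>
    using Sbar_eq_class(1)[OF assms] Sbar_eq_class(1)[OF assms(1) that] Sbar_coeff_unique[OF
        assms(1) that assms(2)]
    by (subst Sbar_class_eq_iff) (auto simp: cusp_forms_scale fourier_coeff_scale[OF N])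
  then show ?thesis
    unfolding Sbar_scale_def using assms(2) by blast
qed

lemma Sbar_scale_in_Sbar: "X \<in> Sbar N k e \<Longrightarrow> Sbar_scale N k e c X \<in> Sbar N k e"
  by (metis Sbar_nonempty Sbar_scale_eq_class Sbar_class_in_Sbar cusp_forms_scale Sbar_eq_class(1))

lemma scale_in_Sbar_scale:
  "X \<in> Sbar N k e \<Longrightarrow> \<phi> \<in> X \<Longrightarrow> (\<lambda>z. c * \<phi> z) \<in> Sbar_scale N k e c X"
  by (metis Sbar_scale_eq_class rep_in_Sbar_class cusp_forms_scale Sbar_eq_class(1))

lemma Sbar_scale_scale:
  assumes "X \<in> Sbar N k e"
  shows "Sbar_scale N k e c (Sbar_scale N k e d X) = Sbar_scale N k e (c * d) X"
proof -
  obtain \<phi> where \<phi>: "\<phi> \<in> X" using Sbar_nonempty[OF assms] by blast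
  show ?thesis
    using Sbar_scale_eq_class[OF Sbar_scale_in_Sbar[OF assms] scale_in_Sbar_scale[OF assms \<phi>]]
      Sbar_scale_eq_class[OF assms \<phi>] by (simp add: mult.assoc)
qed

lemma Sbar_scale_1:
  assumes "X \<in> Sbar N k e"
  shows "Sbar_scale N k e 1 X = X"
proof -
  obtain \<phi> where \<phi>: "\<phi> \<in> X" using Sbar_nonempty[OF assms] by blast
  show ?thesis
    using Sbar_scale_eq_class[OF assms \<phi>, of 1] Sbar_eq_class(2)[OF assms \<phi>] by simp
qed

lemma Sbar_scale_zero_left:
  assumes "X \<in> Sbar N k e"
  shows "Sbar_scale N k e 0 X = Sbar_zero N k e"
proof -
  obtain \<phi> where \<phi>: "\<phi> \<in> X" using Sbar_nonempty[OF assms] by blast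
  show ?thesis
    using Sbar_scale_eq_class[OF assms \<phi>, of 0] by (simp add: Sbar_zero_def)
qed

lemma Sbar_scale_zero_right: "Sbar_scale N k e c (Sbar_zero N k e) = Sbar_zero N k e"
  using Sbar_scale_eq_class[OF Sbar_zero_in_Sbar zero_in_Sbar_zero, of k e c] by (simp add:
      Sbar_zero_def)

lemma Sbar_scale_eq_zero_iff:
  assumes "X \<in> Sbar N k e"
  shows "Sbar_scale N k e c X = Sbar_zero N k e \<longleftrightarrow> c = 0 \<or> X = Sbar_zero N k e"
proof
  assume *: "Sbar_scale N k e c X = Sbar_zero N k e"
  show "c = 0 \<or> X = Sbar_zero N k e"
  proof (cases "c = 0")
    case False
    have "X = Sbar_scale N k e (inverse c) (Sbar_scale N k e c X)"
      using False by (simp add: Sbar_scale_scale[OF assms] Sbar_scale_1[OF assms])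
    then show ?thesis unfolding * Sbar_scale_zero_right by simp
  qed simp
next
  assume "c = 0 \<or> X = Sbar_zero N k e"
  then show "Sbar_scale N k e c X = Sbar_zero N k e"
    using Sbar_scale_zero_left[OF assms] Sbar_scale_zero_right[of k e c] by (elim disjE) simp_all
qed

text \<open>A nonzero class has a nonzero coefficient at some index coprime to \<open>N\<close>,
  which can be cancelled. This will make the values of the character unique.\<close>

lemma Sbar_scale_cancel:
  assumes "X \<in> Sbar N k e" "X \<noteq> Sbar_zero N k e" "Sbar_scale N k e c X = Sbar_scale N k e d X"
  shows "c = d"
proof -
  obtain \<phi> where \<phi>: "\<phi> \<in> X" using Sbar_nonempty[OF assms(1)] by blast
  have cusp: "\<phi> \<in> cusp_forms N k (Gamma_sim N e)" using Sbar_eq_class(1)[OF assms(1) \<phi>] .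
  obtain m1 m2 where m: "coprime m1 N" "coprime m2 N" "fourier_coeff N \<phi> m1 m2 \<noteq> 0"
    using Sbar_eq_zero_iff[OF assms(1) \<phi>] assms(2) by blast
  have "c * fourier_coeff N \<phi> m1 m2 = d * fourier_coeff N \<phi> m1 m2"
    using assms(3) Sbar_class_eq_iff[OF cusp_forms_scale[OF cusp] cusp_forms_scale[OF cusp]] m
    unfolding Sbar_scale_eq_class[OF assms(1) \<phi>] fourier_coeff_scale[OF N cusp] by blast
  then show ?thesis using m(3) by simp
qed

text \<open>
  When the union defining \<open>Sbar_hecke\<close> is a class, some representative is mapped to a cusp form in
  it.  The eigenvector equation guarantees this, so it need not be known that Hecke operators
  preserve cusp forms.
\<close>

lemma Sbar_hecke_rep:
  assumes "Sbar_hecke N k e n1 n2 X \<in> Sbar N k e"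
  obtains \<phi> where "\<phi> \<in> X" "hecke N k n1 n2 \<phi> \<in> Sbar_hecke N k e n1 n2 X"
proof -
  obtain \<psi> where "\<psi> \<in> Sbar_hecke N k e n1 n2 X" using Sbar_nonempty[OF assms] by blast
  then obtain \<phi> where \<phi>: "\<phi> \<in> X" "\<psi> \<in> Sbar_class N k e (hecke N k n1 n2 \<phi>)"
    by (auto simp: Sbar_hecke_def)
  then have "hecke N k n1 n2 \<phi> \<in> Sbar_class N k e (hecke N k n1 n2 \<phi>)"
    by (intro rep_in_Sbar_class Sbar_class_nonemptyD)
  then show ?thesis using that \<phi>(1) by (auto simp: Sbar_hecke_def)
qed

text \<open>The assumptions \<open>Y\<close> and \<open>Y'\<close> take the place of
  well-definedness: both sides are single classes, and both contain \<open>c\<close> times the Hecke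
  image of one representative.\<close>

lemma Sbar_hecke_scale:
  assumes X: "X \<in> Sbar N k e'" and Y: "Sbar_hecke N k e n1 n2 X \<in> Sbar N k e"
    and Y': "Sbar_hecke N k e n1 n2 (Sbar_scale N k e' c X) \<in> Sbar N k e"
  shows "Sbar_hecke N k e n1 n2 (Sbar_scale N k e' c X) = Sbar_scale N k e c (Sbar_hecke N k e n1
      n2 X)"
proof -
  obtain \<phi> where \<phi>: "\<phi> \<in> X" "hecke N k n1 n2 \<phi> \<in> Sbar_hecke N k e n1 n2 X"
    using Sbar_hecke_rep[OF Y] by blast
  have "(\<lambda>z. c * hecke N k n1 n2 \<phi> z) \<in> Sbar_class N k e (hecke N k n1 n2 (\<lambda>z. c * \<phi> z))"
    unfolding hecke_scale using Sbar_eq_class(1)[OF Y \<phi>(2)] by (intro rep_in_Sbar_class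
        cusp_forms_scale)
  then have "(\<lambda>z. c * hecke N k n1 n2 \<phi> z) \<in> Sbar_hecke N k e n1 n2 (Sbar_scale N k e' c X)"
    using scale_in_Sbar_scale[OF X \<phi>(1)] by (auto simp: Sbar_hecke_def)
  then show ?thesis
    using Sbar_eq_class(2)[OF Y'] Sbar_eq_class(2)[OF Sbar_scale_in_Sbar[OF Y]
        scale_in_Sbar_scale[OF Y \<phi>(2)]]
    by metis
qed

text \<open>The zero class is 0 times itself, so this is \<open>Sbar_hecke_scale\<close> with scalar
  0.\<close>

lemma Sbar_hecke_zero:
  assumes "Sbar_hecke N k e n1 n2 (Sbar_zero N k e') \<in> Sbar N k e"
  shows "Sbar_hecke N k e n1 n2 (Sbar_zero N k e') = Sbar_zero N k e"
  using Sbar_hecke_scale[OF Sbar_zero_in_Sbar assms, of 0] assms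
  by (simp add: Sbar_scale_zero_right Sbar_scale_zero_left)

end


subsection \<open>Hecke eigenvectors\<close>

lemma units_mod_simps [simp]:
  "e \<in> carrier (units_mod N) \<longleftrightarrow> 0 \<le> e \<and> e < int N \<and> coprime e (int N)"
  "x \<otimes>\<^bsub>units_mod N\<^esub> y = (x * y) mod int N"
  "\<one>\<^bsub>units_mod N\<^esub> = 1 mod int N"
  by (simp_all add: units_mod_def)

lemma mod_in_units_mod:
  "N \<ge> 1 \<Longrightarrow> coprime a (int N) \<Longrightarrow> a mod int N \<in> carrier (units_mod N)"
  by simp

lemma neg_mod_in_units_mod:
  "N \<ge> 1 \<Longrightarrow> coprime e (int N) \<Longrightarrow> neg_mod N e \<in> carrier (units_mod N)"
  by (simp add: neg_mod_def)

lemma cong_neg_mod: "[neg_mod N e = - e] (mod int N)"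
  by (simp add: neg_mod_def cong_def)

lemma neg_mod_mod: "neg_mod N (a mod int N) = neg_mod N a"
  by (simp add: neg_mod_def mod_minus_eq)

text \<open>The source index e n2/n1 from \<open>SS_hecke\<close> enters through a congruence. This
  avoids inverses in \<open>units_mod\<close> and reads the eigenvector equation one component at a
  time.\<close>

definition hecke_eigenvalue ::
  "nat \<Rightarrow> int \<times> int \<Rightarrow> (int \<Rightarrow> fun2 set) \<Rightarrow> nat \<Rightarrow> nat \<Rightarrow> complex \<Rightarrow> bool" where
  "hecke_eigenvalue N k F n1 n2 c \<longleftrightarrow>
     (\<forall>e\<in>carrier (units_mod N). \<forall>e'\<in>carrier (units_mod N). [e' * int n1 = e * int n2] (mod int N) \<longrightarrow>
        Sbar_hecke N k e n1 n2 (F e') = Sbar_scale N k e c (F e))"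

lemma hecke_eigenvalueD:
  assumes "hecke_eigenvalue N k F n1 n2 c" "e \<in> carrier (units_mod N)" "e' \<in> carrier (units_mod N)"
    and "[e' * int n1 = e * int n2] (mod int N)"
  shows "Sbar_hecke N k e n1 n2 (F e') = Sbar_scale N k e c (F e)"
  using assms unfolding hecke_eigenvalue_def by blast

locale hecke_eigen =
  fixes N :: nat and k :: "int \<times> int" and F :: "int \<Rightarrow> fun2 set"
  assumes N: "N \<ge> 1" and eigen: "hecke_eigenvector N k F"
begin

abbreviation e0 :: int where "e0 \<equiv> neg_mod N 1"

lemma e0: "e0 \<in> carrier (units_mod N)"
  using N by (intro neg_mod_in_units_mod) auto

lemma component_in_Sbar: "e \<in> carrier (units_mod N) \<Longrightarrow> F e \<in> Sbar N k e"
  using eigen unfolding hecke_eigenvector_def SS_def by (blast dest: PiE_mem)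

lemma eigenvalue_exists:
  assumes "n1 > 0" "n2 > 0" "coprime n1 N" "coprime n2 N"
  obtains c where "hecke_eigenvalue N k F n1 n2 c"
proof -
  interpret comm_group "units_mod N" by (rule comm_group_units_mod[OF N])
  obtain c where c: "SS_hecke N k n1 n2 F = SS_scale N k c F"
    using eigen assms unfolding hecke_eigenvector_def by blast
  have "hecke_eigenvalue N k F n1 n2 c"
    unfolding hecke_eigenvalue_def
  proof (intro ballI impI)
    fix e e' assume e: "e \<in> carrier (units_mod N)" and e': "e' \<in> carrier (units_mod N)"
      and cong: "[e' * int n1 = e * int n2] (mod int N)"
    have n: "int n1 mod int N \<in> carrier (units_mod N)" "int n2 mod int N \<in> carrier (units_mod N)"
      using assms N by (auto intro!: mod_in_units_mod simp del: units_mod_simps)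
    have "e' \<otimes>\<^bsub>units_mod N\<^esub> (int n1 mod int N) = e \<otimes>\<^bsub>units_mod N\<^esub> (int n2 mod int N)"
      using cong by (simp add: cong_def mod_simps)
    then have "e \<otimes>\<^bsub>units_mod N\<^esub> (int n2 mod int N) \<otimes>\<^bsub>units_mod N\<^esub> inv\<^bsub>units_mod N\<^esub> (int n1 mod int
        N) = e'"
      using inv_solve_right[OF e' m_closed[OF e n(2)] n(1)] by metis
    then show "Sbar_hecke N k e n1 n2 (F e') = Sbar_scale N k e c (F e)"
      using fun_cong[OF c, of e] e unfolding SS_hecke_def SS_scale_def by (simp del:
          units_mod_simps)
  qed
  then show ?thesis using that by blast
qed

text \<open>A zero source component would be mapped to zero, but a nonzero multiple of the nonzero
  target component is not zero.\<close>

lemma nonzero_source: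
  assumes "hecke_eigenvalue N k F n1 n2 c" "c \<noteq> 0"
    and e: "e \<in> carrier (units_mod N)" "e' \<in> carrier (units_mod N)" "[e' * int n1 = e * int n2]
        (mod int N)"
    and "F e \<noteq> Sbar_zero N k e"
  shows "F e' \<noteq> Sbar_zero N k e'"
proof
  assume 0: "F e' = Sbar_zero N k e'"
  have eq: "Sbar_hecke N k e n1 n2 (F e') = Sbar_scale N k e c (F e)"
    by (rule hecke_eigenvalueD) fact+
  moreover have "Sbar_scale N k e c (F e) \<in> Sbar N k e"
    by (intro Sbar_scale_in_Sbar N component_in_Sbar e)
  ultimately have "Sbar_scale N k e c (F e) = Sbar_zero N k e"
    using Sbar_hecke_zero[OF N] unfolding 0 by metis
  then show False
    using Sbar_scale_eq_zero_iff[OF N component_in_Sbar[OF e(1)]] assms(2,6) by blast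
qed

text \<open>
  A nonzero coefficient at \<open>(n1, n2)\<close> of the component at \<open>e\<close> is the coefficient at \<open>(1, 1)\<close> of its
  image under the Hecke operator, which by the support condition lies in the component at \<open>-1\<close>.
\<close>

lemma nonzero_component:
  assumes e: "e \<in> carrier (units_mod N)" and nz: "F e \<noteq> Sbar_zero N k e"
  obtains n1 n2 c where "n1 > 0" "n2 > 0" "coprime n1 N" "coprime n2 N"
    "[e * int n1 = - int n2] (mod int N)" "hecke_eigenvalue N k F n1 n2 c" "c \<noteq> 0"
    "F e0 \<noteq> Sbar_zero N k e0" "\<And>\<psi>. \<psi> \<in> F e0 \<Longrightarrow> fourier_coeff N \<psi> 1 1 \<noteq> 0"
proof -
  note Fe = component_in_Sbar[OF e] and Fe0 = component_in_Sbar[OF e0]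
  obtain \<phi> where \<phi>: "\<phi> \<in> F e" using Sbar_nonempty[OF N Fe] by blast
  obtain n1 n2 where n: "coprime n1 N" "coprime n2 N" "fourier_coeff N \<phi> n1 n2 \<noteq> 0"
    using Sbar_eq_zero_iff[OF N Fe \<phi>] nz by blast
  have cusp: "\<phi> \<in> cusp_forms N k (Gamma_sim N e)" using Sbar_eq_class(1)[OF N Fe \<phi>] .
  \<comment> \<open>If \<open>N = 1\<close>, the index 0 is coprime to \<open>N\<close>; cuspidality
    excludes it, so that the operator T(n1, n2) is available.\<close>
  have pos: "n1 > 0" "n2 > 0" using cusp_form_q_expansion(2)[OF N cusp, of n1 n2] n(3) by (metis
      not_gr_zero)+
  have cong: "[e * int n1 = - int n2] (mod int N)"
    using cusp_form_support[OF N cusp n(3)] by (simp add: cong_iff_dvd_diff)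
  obtain c where c: "hecke_eigenvalue N k F n1 n2 c"
    using eigenvalue_exists pos n by blast
  have "[e0 * int n2 = - 1 * int n2] (mod int N)"
    by (intro cong_mult cong_refl cong_neg_mod)
  then have "[e * int n1 = e0 * int n2] (mod int N)"
    using cong by (simp add: cong_def)
  then have eq: "Sbar_hecke N k e0 n1 n2 (F e) = Sbar_scale N k e0 c (F e0)"
    by (rule hecke_eigenvalueD[OF c e0 e])
  have S: "Sbar_scale N k e0 c (F e0) \<in> Sbar N k e0"
    by (rule Sbar_scale_in_Sbar[OF N Fe0])
  \<comment> \<open>The representative whose Hecke image is known to lie in the class may differ
    from \<open>\<phi>\<close>, but both have the same coefficients at indices coprime to
    \<open>N\<close>.\<close>
  obtain \<phi>' where \<phi>': "\<phi>' \<in> F e" "hecke N k n1 n2 \<phi>' \<in> Sbar_scale N k e0 c (F e0)"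
    using Sbar_hecke_rep[OF N, of k e0 n1 n2 "F e"] S unfolding eq by blast
  have "fourier_coeff N (hecke N k n1 n2 \<phi>') 1 1 = fourier_coeff N \<phi>' n1 n2"
    using hecke_fourier_coeff_coprime[OF N pos n(1,2) Sbar_eq_class(1)[OF N Fe \<phi>'(1)], of 1 1] by
        simp
  then have nz11: "fourier_coeff N (hecke N k n1 n2 \<phi>') 1 1 \<noteq> 0"
    using Sbar_coeff_unique[OF N Fe \<phi> \<phi>'(1) n(1,2)] n(3) by simp
  then have "Sbar_scale N k e0 c (F e0) \<noteq> Sbar_zero N k e0"
    using Sbar_eq_zero_iff[OF N S \<phi>'(2)] by (metis coprime_1_left)
  then have "c \<noteq> 0" "F e0 \<noteq> Sbar_zero N k e0"
    using Sbar_scale_eq_zero_iff[OF N Fe0] by blast+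
  moreover have "fourier_coeff N \<psi> 1 1 \<noteq> 0" if \<psi>: "\<psi> \<in> F e0" for \<psi>
  proof -
    have "fourier_coeff N (hecke N k n1 n2 \<phi>') 1 1 = fourier_coeff N (\<lambda>z. c * \<psi> z) 1 1"
      by (rule Sbar_coeff_unique[OF N S \<phi>'(2) scale_in_Sbar_scale[OF N Fe0 \<psi>]]) simp_all
    also have "\<dots> = c * fourier_coeff N \<psi> 1 1"
      by (rule fourier_coeff_scale[OF N Sbar_eq_class(1)[OF N Fe0 \<psi>]])
    finally show ?thesis using nz11 by auto
  qed
  ultimately show ?thesis
    using that pos n(1,2) cong c by blast
qed

text \<open>Some component of a nonzero eigenvector is nonzero, and \<open>nonzero_component\<close>
  transports this to the index -1.\<close>

lemma e0_nonzero: "F e0 \<noteq> Sbar_zero N k e0" "\<psi> \<in> F e0 \<Longrightarrow> fourier_coeff N \<psi> 1 1 \<noteq> 0"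
proof -
  have ext: "F \<in> extensional (carrier (units_mod N))"
    using eigen unfolding hecke_eigenvector_def SS_def PiE_def by (elim conjE IntE)
  have "\<exists>e. e \<in> carrier (units_mod N) \<and> F e \<noteq> Sbar_zero N k e"
  proof (rule ccontr)
    assume "\<not> ?thesis"
    then have "F = SS_zero N k"
      unfolding SS_zero_def by (intro extensionalityI[OF ext restrict_extensional]) simp
    then show False using eigen by (simp add: hecke_eigenvector_def)
  qed
  then obtain e where e: "e \<in> carrier (units_mod N)" "F e \<noteq> Sbar_zero N k e" by blast
  show "F e0 \<noteq> Sbar_zero N k e0"
    by (rule nonzero_component[OF e])
  show "fourier_coeff N \<psi> 1 1 \<noteq> 0" if "\<psi> \<in> F e0"
    by (rule nonzero_component[OF e]) (use that in blast)
qed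

lemma Hset_iff: "x \<in> Hset N k F \<longleftrightarrow> x \<in> carrier (units_mod N) \<and> F (neg_mod N x) \<noteq> Sbar_zero N k
    (neg_mod N x)"
  by (simp add: Hset_def)

lemma neg_mod_carrier: "x \<in> carrier (units_mod N) \<Longrightarrow> neg_mod N x \<in> carrier (units_mod N)"
  using N by (intro neg_mod_in_units_mod) auto

text \<open>Some operator with n2/n1 = x has nonzero eigenvalue. It maps the component at -x y to a
  nonzero multiple of the component at -y, which is nonzero.\<close>

lemma Hset_mult:
  assumes x: "x \<in> Hset N k F" and y: "y \<in> Hset N k F"
  shows "x \<otimes>\<^bsub>units_mod N\<^esub> y \<in> Hset N k F"
proof -
  interpret comm_group "units_mod N" by (rule comm_group_units_mod[OF N])
  have xc: "x \<in> carrier (units_mod N)" and yc: "y \<in> carrier (units_mod N)"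
    using x y by (simp_all only: Hset_iff)
  note xyc = m_closed[OF xc yc]
  obtain n1 n2 c where n: "[neg_mod N x * int n1 = - int n2] (mod int N)"
    "hecke_eigenvalue N k F n1 n2 c" "c \<noteq> 0"
    using nonzero_component[OF neg_mod_carrier[OF xc]] x unfolding Hset_iff by metis
  have "[neg_mod N (x \<otimes>\<^bsub>units_mod N\<^esub> y) * int n1 = neg_mod N y * int n2] (mod int N)"
  proof -
    have "[neg_mod N (x \<otimes>\<^bsub>units_mod N\<^esub> y) * int n1 = - (x * y) * int n1] (mod int N)"
      by (simp only: units_mod_simps neg_mod_mod) (intro cong_mult cong_refl cong_neg_mod)
    moreover have "[neg_mod N x * int n1 * y = - int n2 * y] (mod int N)"
      by (intro cong_mult cong_refl n(1))
    moreover have "[neg_mod N x * int n1 * y = - x * int n1 * y] (mod int N)"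
      "[neg_mod N y * int n2 = - y * int n2] (mod int N)"
      by (intro cong_mult cong_refl cong_neg_mod)+
    ultimately show ?thesis by (simp add: cong_def mult_ac)
  qed
  then have "F (neg_mod N (x \<otimes>\<^bsub>units_mod N\<^esub> y)) \<noteq> Sbar_zero N k (neg_mod N (x \<otimes>\<^bsub>units_mod N\<^esub> y))"
    by (rule nonzero_source[OF n(2,3) neg_mod_carrier[OF yc] neg_mod_carrier[OF xyc] _
          y[unfolded Hset_iff, THEN conjunct2]])
  then show ?thesis using xyc unfolding Hset_iff by blast
qed

lemma Hset_one: "\<one>\<^bsub>units_mod N\<^esub> \<in> Hset N k F"
  using e0_nonzero(1) N by (simp add: Hset_iff neg_mod_mod)

lemma finite_units_mod: "finite (carrier (units_mod N))"
  by (rule finite_subset[of _ "{0..<int N}"]) auto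

lemma subgroup_Hset: "subgroup (Hset N k F) (units_mod N)"
proof -
  interpret comm_group "units_mod N" by (rule comm_group_units_mod[OF N])
  have pow: "x [^]\<^bsub>units_mod N\<^esub> (n :: nat) \<in> Hset N k F" if "x \<in> Hset N k F" for x n
    using that Hset_mult Hset_one by (induction n) (simp_all del: units_mod_simps)
  show ?thesis
  proof
    show "Hset N k F \<subseteq> carrier (units_mod N)" by (auto simp only: Hset_iff)
    fix x assume x: "x \<in> Hset N k F"
    then have xc: "x \<in> carrier (units_mod N)" by (simp only: Hset_iff)
    \<comment> \<open>In a finite group the inverse is a power, so closure under multiplication is
      enough.\<close>
    have "order (units_mod N) > 0"
      using finite_units_mod by (simp add: order_gt_0_iff_finite del: units_mod_simps)
    then have "x [^]\<^bsub>units_mod N\<^esub> (order (units_mod N) - 1) \<otimes>\<^bsub>units_mod N\<^esub> x = \<one>\<^bsub>units_mod N\<^esub>"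
      using pow_order_eq_1[OF xc] by (metis Suc_diff_1 nat_pow_Suc)
    then have "inv\<^bsub>units_mod N\<^esub> x = x [^]\<^bsub>units_mod N\<^esub> (order (units_mod N) - 1)"
      using xc by (intro inv_equality) (simp_all del: units_mod_simps)
    then show "inv\<^bsub>units_mod N\<^esub> x \<in> Hset N k F" using pow[OF x] by simp
  qed (use Hset_mult Hset_one in auto)
qed

text \<open>Applying \<open>nonzero_component\<close> to the inverse of \<open>x\<close> gives an
  operator that leads from the component at -1 to the one at -x, the direction needed to compare two
  eigenvectors.\<close>

lemma Hset_eigenvalue:
  assumes x: "x \<in> Hset N k F"
  obtains n1 n2 c where "n1 > 0" "n2 > 0" "coprime n1 N" "coprime n2 N"
    "[int n1 = x * int n2] (mod int N)" "hecke_eigenvalue N k F n1 n2 c" "c \<noteq> 0"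
proof -
  interpret comm_group "units_mod N" by (rule comm_group_units_mod[OF N])
  define y where "y = inv\<^bsub>units_mod N\<^esub> x"
  have xc: "x \<in> carrier (units_mod N)" using x by (simp only: Hset_iff)
  have y: "y \<in> Hset N k F" unfolding y_def by (rule subgroup.m_inv_closed[OF subgroup_Hset x])
  then have yc: "y \<in> carrier (units_mod N)" by (simp only: Hset_iff)
  have "x \<otimes>\<^bsub>units_mod N\<^esub> y = \<one>\<^bsub>units_mod N\<^esub>" unfolding y_def by (rule r_inv[OF xc])
  then have xy: "[x * y = 1] (mod int N)" by (simp add: cong_def)
  obtain n1 n2 c where n: "n1 > 0" "n2 > 0" "coprime n1 N" "coprime n2 N"
    "[neg_mod N y * int n1 = - int n2] (mod int N)" "hecke_eigenvalue N k F n1 n2 c" "c \<noteq> 0"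
    using nonzero_component[OF neg_mod_carrier[OF yc]] y unfolding Hset_iff by metis
  have "[- y * int n1 = neg_mod N y * int n1] (mod int N)"
    by (intro cong_mult cong_refl cong_sym[OF cong_neg_mod])
  then have "[- y * int n1 = - int n2] (mod int N)"
    using n(5) cong_trans by blast
  then have "[(- x) * (- y * int n1) = (- x) * (- int n2)] (mod int N)"
    by (intro cong_mult cong_refl)
  moreover have "[(x * y) * int n1 = 1 * int n1] (mod int N)"
    by (intro cong_mult cong_refl xy)
  ultimately have "[int n1 = x * int n2] (mod int N)"
    by (simp add: cong_def mult_ac)
  then show ?thesis using that n by blast
qed

lemma cong_index:
  assumes "[int n1 = x * int n2] (mod int N)"
  shows "[neg_mod N y * int n1 = neg_mod N (x \<otimes>\<^bsub>units_mod N\<^esub> y) * int n2] (mod int N)"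
proof -
  have "[neg_mod N (x \<otimes>\<^bsub>units_mod N\<^esub> y) * int n2 = - (x * y) * int n2] (mod int N)"
    by (simp only: units_mod_simps neg_mod_mod) (intro cong_mult cong_refl cong_neg_mod)
  moreover have "[neg_mod N y * int n1 = - y * (x * int n2)] (mod int N)"
    by (intro cong_mult assms cong_neg_mod)
  ultimately show ?thesis by (simp add: cong_def mult_ac)
qed

section \<open>Squares belong to \<open>H\<close>\<close>

lemma prime_square_in_Hset:
  assumes p: "prime p" "coprime p N"
  shows "int (p * p) mod int N \<in> Hset N k F"
proof (rule ccontr)
  assume no2: "int (p * p) mod int N \<notin> Hset N k F"
  define a where "a = int p mod int N"
  have p0: "p > 0" using p(1) prime_gt_0_nat by blast
  have "a \<otimes>\<^bsub>units_mod N\<^esub> a = int (p * p) mod int N"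
    by (simp add: a_def mod_simps)
  then have no1: "a \<notin> Hset N k F" using no2 Hset_mult by metis
  \<comment> \<open>T(n, 1) maps the component at -1 into the space at -n, to a multiple of the
    component there. For n outside \<open>H\<close> that component is zero, so the operator
    annihilates the component at -1.\<close>
  have null: "\<exists>\<phi>\<in>F e0. \<forall>m1 m2. coprime m1 N \<and> coprime m2 N \<longrightarrow> fourier_coeff N (hecke N k n 1 \<phi>) m1
      m2 = 0"
    if n: "n > 0" "coprime n N" and no: "int n mod int N \<notin> Hset N k F" for n
  proof -
    define t where "t = neg_mod N (int n)"
    have nc: "int n mod int N \<in> carrier (units_mod N)"
      using n N by (intro mod_in_units_mod) auto
    have t: "t \<in> carrier (units_mod N)"
      unfolding t_def using n N by (intro neg_mod_in_units_mod) auto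
    have Ft: "F t = Sbar_zero N k t"
      using no nc unfolding Hset_iff neg_mod_mod t_def by blast
    obtain c where c: "hecke_eigenvalue N k F n 1 c"
      using eigenvalue_exists[OF n(1) _ n(2), of 1] by auto
    have "[e0 * int n = - 1 * int n] (mod int N)" by (intro cong_mult cong_refl cong_neg_mod)
    moreover have "[t = - int n] (mod int N)" unfolding t_def by (rule cong_neg_mod)
    ultimately have "[e0 * int n = t * int 1] (mod int N)" by (simp add: cong_def)
    then have "Sbar_hecke N k t n 1 (F e0) = Sbar_scale N k t c (F t)"
      by (rule hecke_eigenvalueD[OF c t e0])
    also have "\<dots> = Sbar_zero N k t" unfolding Ft by (rule Sbar_scale_zero_right[OF N])
    finally have eq: "Sbar_hecke N k t n 1 (F e0) = Sbar_zero N k t" .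
    obtain \<phi> where "\<phi> \<in> F e0" "hecke N k n 1 \<phi> \<in> Sbar_zero N k t"
      using Sbar_hecke_rep[OF N, of k t n 1 "F e0"] Sbar_zero_in_Sbar[OF N] unfolding eq by blast
    then show ?thesis
      using Sbar_eq_zero_iff[OF N Sbar_zero_in_Sbar[OF N]] by blast
  qed
  obtain \<phi> where \<phi>: "\<phi> \<in> F e0"
    "\<And>m1 m2. coprime m1 N \<Longrightarrow> coprime m2 N \<Longrightarrow> fourier_coeff N (hecke N k p 1 \<phi>) m1 m2 = 0"
    using null[OF p0 p(2)] no1 unfolding a_def by blast
  obtain \<phi>' where \<phi>': "\<phi>' \<in> F e0"
    "\<And>m1 m2. coprime m1 N \<Longrightarrow> coprime m2 N \<Longrightarrow> fourier_coeff N (hecke N k (p * p) 1 \<phi>') m1 m2 = 0"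
    using null[of "p * p"] p0 p(2) no2 by auto
  note Fe0 = component_in_Sbar[OF e0]
  have cusp: "\<phi> \<in> cusp_forms N k (Gamma_sim N e0)" "\<phi>' \<in> cusp_forms N k (Gamma_sim N e0)"
    using Sbar_eq_class(1)[OF N Fe0] \<phi>(1) \<phi>'(1) by blast+
  have "fourier_coeff N \<phi> 1 1 = 0"
  proof (rule diamond_coeff_injective[OF N p _ cusp(1)])
    show "coprime e0 (int N)" using e0 by simp
    \<comment> \<open>The coefficient of T(p, 1) at (p m1, m2) is c(p^2 m1, m2) plus a nonzero
      multiple of the diamond coefficient at (m1, m2). The vanishing of T(p^2, 1) at (m1, m2)
      removes the first summand, hence also the second.\<close>
    fix m1 m2 assume m: "coprime m1 (p * N)" "coprime m2 N"
    then have m1: "coprime m1 N" "coprime (p * p) m1" by (auto simp: coprime_commute)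
    have "fourier_coeff N \<phi>' (m1 * (p * p)) (m2 * 1) = fourier_coeff N (hecke N k (p * p) 1 \<phi>') m1
        m2"
      using p0 p(2) m1 by (intro hecke_fourier_coeff_coprime[OF N _ _ _ _ cusp(2), symmetric]) auto
    also have "\<dots> = 0" using \<phi>'(2) m1 m by blast
    finally have "fourier_coeff N \<phi>' (p * m1 * p) m2 = 0" by (simp add: mult_ac)
    moreover have "fourier_coeff N \<phi> (p * m1 * p) m2 = fourier_coeff N \<phi>' (p * m1 * p) m2"
      using p(2) m1 m by (intro Sbar_coeff_unique[OF N Fe0 \<phi>(1) \<phi>'(1)]) auto
    moreover have "fourier_coeff N (hecke N k p 1 \<phi>) (p * m1) m2 = 0"
      using p(2) m1 m by (intro \<phi>(2)) auto
    ultimately show "fourier_coeff N (slash k (sigma_mat N p, sigma_mat N 1) \<phi>) m1 m2 = 0"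
      using hecke_fourier_coeff_prime[OF N p cusp(1), of m1 m2] p0 by simp
  qed
  then show False using e0_nonzero(2)[OF \<phi>(1)] by blast
qed

lemma square_in_Hset:
  assumes "n > 0" "coprime n N"
  shows "int (n * n) mod int N \<in> Hset N k F"
  using assms
proof (induction n rule: less_induct)
  case (less n)
  show ?case
  proof (cases "n = 1")
    case True
    then show ?thesis using Hset_one by simp
  next
    case False
    then obtain p where p: "prime p" "p dvd n" using prime_factor_nat by blast
    then obtain m where m: "n = p * m" by blast
    have "p > 1" "m > 0" using p less.prems m prime_gt_1_nat by auto
    moreover have co: "coprime p N" "coprime m N" using less.prems(2) m by auto
    ultimately have "int (m * m) mod int N \<in> Hset N k F"
      by (intro less.IH) (auto simp: m)
    from Hset_mult[OF prime_square_in_Hset[OF p(1) co(1)] this]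
    have "int (p * p) * int (m * m) mod int N \<in> Hset N k F"
      by (simp only: units_mod_simps mod_mult_eq)
    moreover have "int (p * p) * int (m * m) = int (n * n)" by (simp add: m)
    ultimately show ?thesis by (simp only:)
  qed
qed

lemma carrier_square_in_Hset:
  assumes "x \<in> carrier (units_mod N)"
  shows "x \<otimes>\<^bsub>units_mod N\<^esub> x \<in> Hset N k F"
proof -
  \<comment> \<open>Adding \<open>N\<close> keeps \<open>n\<close> positive even for
    \<open>N = 1\<close>, where \<open>x = 0\<close>.\<close>
  define n where "n = nat x + N"
  have n: "int n = x + int N" using assms by (simp add: n_def)
  have "coprime (int n) (int N)" using assms by (simp add: n coprime_iff_gcd_eq_1)
  then have "coprime n N" unfolding coprime_int_iff .
  then have "int (n * n) mod int N \<in> Hset N k F"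
    using N by (intro square_in_Hset) (auto simp: n_def)
  moreover have "[int n * int n = x * x] (mod int N)"
    by (intro cong_mult) (simp_all add: n cong_def)
  ultimately show ?thesis by (simp add: cong_def)
qed

end

section \<open>Two eigenvectors with the same component at -1\<close>

lemma Hset_same_base:
  assumes F: "hecke_eigen N k F" and G: "hecke_eigen N k G"
    and base: "G (neg_mod N 1) = F (neg_mod N 1)" and x: "x \<in> Hset N k F"
  obtains n1 n2 c d where "n1 > 0" "n2 > 0" "[int n1 = x * int n2] (mod int N)"
    "hecke_eigenvalue N k F n1 n2 c" "hecke_eigenvalue N k G n1 n2 d" "c \<noteq> 0" "d \<noteq> 0"
    "G (neg_mod N x) = Sbar_scale N k (neg_mod N x) (c / d) (F (neg_mod N x))" "x \<in> Hset N k G"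
proof -
  interpret F: hecke_eigen N k F by fact
  interpret G: hecke_eigen N k G by fact
  note N = F.N
  have xc: "x \<in> carrier (units_mod N)" using x by (simp only: F.Hset_iff)
  note nx = F.neg_mod_carrier[OF xc]
  obtain n1 n2 c where n: "n1 > 0" "n2 > 0" "coprime n1 N" "coprime n2 N"
    "[int n1 = x * int n2] (mod int N)" "hecke_eigenvalue N k F n1 n2 c" "c \<noteq> 0"
    using F.Hset_eigenvalue[OF x] by blast
  obtain d where d: "hecke_eigenvalue N k G n1 n2 d"
    using G.eigenvalue_exists[OF n(1-4)] by blast
  have cong: "[neg_mod N 1 * int n1 = neg_mod N x * int n2] (mod int N)"
    using F.cong_index[OF n(5), of 1] by (simp add: neg_mod_mod)
  \<comment> \<open>T(n1, n2) sends the common component at -1 both to \<open>c\<close> times the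
    component of \<open>F\<close> at -x and to \<open>d\<close> times that of \<open>G\<close>. The
    former is nonzero, so neither \<open>d\<close> nor the component of \<open>G\<close>
    vanishes.\<close>
  have eq: "Sbar_scale N k (neg_mod N x) d (G (neg_mod N x)) = Sbar_scale N k (neg_mod N x) c (F
      (neg_mod N x))"
    using hecke_eigenvalueD[OF n(6) nx F.e0 cong] hecke_eigenvalueD[OF d nx F.e0 cong] base by simp
  have "F (neg_mod N x) \<noteq> Sbar_zero N k (neg_mod N x)" using x unfolding F.Hset_iff by (rule
      conjunct2)
  then have "Sbar_scale N k (neg_mod N x) d (G (neg_mod N x)) \<noteq> Sbar_zero N k (neg_mod N x)"
    unfolding eq using Sbar_scale_eq_zero_iff[OF N F.component_in_Sbar[OF nx]] n(7) by blast
  then have d0: "d \<noteq> 0" and Gx: "G (neg_mod N x) \<noteq> Sbar_zero N k (neg_mod N x)"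
    using Sbar_scale_eq_zero_iff[OF N G.component_in_Sbar[OF nx]] by blast+
  have "G (neg_mod N x) = Sbar_scale N k (neg_mod N x) (inverse d)
      (Sbar_scale N k (neg_mod N x) d (G (neg_mod N x)))"
    using d0 by (simp add: Sbar_scale_scale[OF N G.component_in_Sbar[OF nx]] Sbar_scale_1[OF N
        G.component_in_Sbar[OF nx]])
  also have "\<dots> = Sbar_scale N k (neg_mod N x) (c / d) (F (neg_mod N x))"
    unfolding eq Sbar_scale_scale[OF N F.component_in_Sbar[OF nx]] by (simp add: field_simps)
  finally show ?thesis
    using that n d d0 Gx xc by (simp only: G.Hset_iff) blast
qed

text \<open>The value at \<open>x\<close> is the ratio \<open>c / d\<close> of the two eigenvalues
  of an operator leading from -1 to -x; it is unique since the component of \<open>F\<close> at -x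
  is nonzero. The same operator leads from -y to -x y, which gives multiplicativity.\<close>

lemma character_of_same_base:
  assumes F: "hecke_eigen N k F" and G: "hecke_eigen N k G"
    and base: "G (neg_mod N 1) = F (neg_mod N 1)"
  shows "\<exists>\<psi> \<in> hom ((units_mod N)\<lparr>carrier := Hset N k F\<rparr>) complex_units.
    \<forall>e \<in> Hset N k F. G (neg_mod N e) = Sbar_scale N k (neg_mod N e) (\<psi> e) (F (neg_mod N e))"
proof -
  interpret F: hecke_eigen N k F by fact
  interpret G: hecke_eigen N k G by fact
  note N = F.N
  interpret comm_group "units_mod N" by (rule comm_group_units_mod[OF N])
  define \<psi> where "\<psi> x = (SOME a. G (neg_mod N x) = Sbar_scale N k (neg_mod N x) a (F (neg_mod N
      x)))" for x
  have carr: "x \<in> carrier (units_mod N)" if "x \<in> Hset N k F" for x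
    using that by (simp only: F.Hset_iff)
  have \<psi>: "G (neg_mod N x) = Sbar_scale N k (neg_mod N x) (\<psi> x) (F (neg_mod N x))" if "x \<in> Hset N
      k F" for x
  proof -
    have "\<exists>a. G (neg_mod N x) = Sbar_scale N k (neg_mod N x) a (F (neg_mod N x))"
      by (rule Hset_same_base[OF F G base that]) blast
    then show ?thesis unfolding \<psi>_def by (rule someI_ex)
  qed
  have uniq: "\<psi> x = a" if x: "x \<in> Hset N k F"
    and a: "G (neg_mod N x) = Sbar_scale N k (neg_mod N x) a (F (neg_mod N x))" for x a
    using Sbar_scale_cancel[OF N F.component_in_Sbar[OF F.neg_mod_carrier[OF carr[OF x]]]] x \<psi>[OF
        x] a
    by (simp only: F.Hset_iff) metis
  have "\<psi> (x \<otimes>\<^bsub>units_mod N\<^esub> y) = \<psi> x * \<psi> y" if x: "x \<in> Hset N k F" and y: "y \<in> Hset N k F" for x y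
  proof -
    define t where "t = neg_mod N (x \<otimes>\<^bsub>units_mod N\<^esub> y)"
    have xy: "x \<otimes>\<^bsub>units_mod N\<^esub> y \<in> Hset N k F" by (rule F.Hset_mult[OF x y])
    have t: "t \<in> carrier (units_mod N)" unfolding t_def by (rule F.neg_mod_carrier[OF carr[OF xy]])
    have ny: "neg_mod N y \<in> carrier (units_mod N)" by (rule F.neg_mod_carrier[OF carr[OF y]])
    obtain n1 n2 c d where n: "[int n1 = x * int n2] (mod int N)"
      "hecke_eigenvalue N k F n1 n2 c" "hecke_eigenvalue N k G n1 n2 d" "c \<noteq> 0" "d \<noteq> 0"
      "G (neg_mod N x) = Sbar_scale N k (neg_mod N x) (c / d) (F (neg_mod N x))"
      using Hset_same_base[OF F G base x] by metis
    have cong: "[neg_mod N y * int n1 = t * int n2] (mod int N)"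
      unfolding t_def by (rule F.cong_index[OF n(1)])
    note TF = hecke_eigenvalueD[OF n(2) t ny cong] and TG = hecke_eigenvalueD[OF n(3) t ny cong]
    note Ft = F.component_in_Sbar[OF t] and Gt = G.component_in_Sbar[OF t]
    \<comment> \<open>The operator is applied to the component of \<open>G\<close> at -y, once
      directly and once as \<open>\<psi> y\<close> times the component of \<open>F\<close>.\<close>
    have "Sbar_scale N k t d (G t) = Sbar_scale N k t (\<psi> y) (Sbar_scale N k t c (F t))"
      using Sbar_hecke_scale[OF N F.component_in_Sbar[OF ny], of t n1 n2 "\<psi> y"]
        TF TG \<psi>[OF y] Sbar_scale_in_Sbar[OF N Ft] Sbar_scale_in_Sbar[OF N Gt] by simp
    then have "Sbar_scale N k t (inverse d) (Sbar_scale N k t d (G t)) = Sbar_scale N k t (inverse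
        d * (\<psi> y * c)) (F t)"
      by (simp add: Sbar_scale_scale[OF N Ft])
    then have "G t = Sbar_scale N k t (c / d * \<psi> y) (F t)"
      using n(5) by (simp add: Sbar_scale_scale[OF N Gt] Sbar_scale_1[OF N Gt] field_simps)
    then have "\<psi> (x \<otimes>\<^bsub>units_mod N\<^esub> y) = c / d * \<psi> y"
      using uniq[OF xy] unfolding t_def by blast
    moreover have "\<psi> x = c / d" using uniq[OF x n(6)] .
    ultimately show ?thesis by simp
  qed
  moreover have "\<psi> x \<noteq> 0" if x: "x \<in> Hset N k F" for x
  proof -
    obtain c d where "c \<noteq> 0" "d \<noteq> 0"
      "G (neg_mod N x) = Sbar_scale N k (neg_mod N x) (c / d) (F (neg_mod N x))"
      using Hset_same_base[OF F G base x] by metis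
    then show ?thesis using uniq[OF x] by simp
  qed
  ultimately have "\<psi> \<in> hom ((units_mod N)\<lparr>carrier := Hset N k F\<rparr>) complex_units"
    by (auto simp: hom_def complex_units_def simp del: units_mod_simps)
  then show ?thesis using \<psi> by blast
qed

section \<open>Orders in the quotient by \<open>H\<close>, and the theorem\<close>

lemma ord_quotient_of_squares:
  fixes G (structure)
  assumes "comm_group G" "subgroup H G" and sq: "\<And>a. a \<in> carrier G \<Longrightarrow> a \<otimes> a \<in> H"
    and x: "x \<in> carrier (G Mod H)"
  shows "group.ord (G Mod H) x \<in> {1, 2}"
proof -
  interpret comm_group G by fact
  have nrm: "H \<lhd> G" using assms(2) by (rule subgroup_imp_normal)
  interpret Q: group "G Mod H" by (rule normal.factorgroup_is_group[OF nrm])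
  obtain a where a: "a \<in> carrier G" "x = H #> a"
    using x by (auto simp: FactGroup_def RCOSETS_def)
  have "x \<otimes>\<^bsub>G Mod H\<^esub> x = H #> (a \<otimes> a)"
    using a normal.rcos_sum[OF nrm] by (simp add: FactGroup_def)
  also have "\<dots> = H" using subgroup.rcos_const[OF assms(2) group_axioms sq[OF a(1)]] .
  also have "\<dots> = \<one>\<^bsub>G Mod H\<^esub>" by (simp add: FactGroup_def)
  finally have "x [^]\<^bsub>G Mod H\<^esub> (2 :: nat) = \<one>\<^bsub>G Mod H\<^esub>"
    by (simp only: numeral_2_eq_2 Q.nat_pow_Suc Q.nat_pow_0 Q.l_one[OF x])
  then have "Q.ord x dvd 2" using Q.pow_eq_id[OF x] by blast
  then show ?thesis
    using prime_nat_iff[of 2] two_is_prime_nat by auto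
qed

theorem theorem5p3:
  fixes N :: nat and k :: "int \<times> int"
    and f :: "int \<Rightarrow> fun2 set"
  assumes "N \<ge> 1"
    and "hecke_eigenvector N k f"
  shows "subgroup (Hset N k f) (units_mod N) \<and>
    (\<forall>g. hecke_eigenvector N k g \<and> g (neg_mod N 1) = f (neg_mod N 1) \<longrightarrow>
       Hset N k g = Hset N k f) \<and>
    (\<forall>x \<in> carrier (units_mod N Mod Hset N k f).
       group.ord (units_mod N Mod Hset N k f) x \<in> {1, 2}) \<and>
    (\<forall>g. hecke_eigenvector N k g \<longrightarrow>
       (g (neg_mod N 1) = f (neg_mod N 1) \<longleftrightarrow>
        (\<exists>\<psi> \<in> hom ((units_mod N)\<lparr>carrier := Hset N k f\<rparr>) complex_units.
           \<forall>e \<in> Hset N k f.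
             g (neg_mod N e) = Sbar_scale N k (neg_mod N e) (\<psi> e) (f (neg_mod N e)))))"
proof (intro conjI allI impI ballI)
  have f: "hecke_eigen N k f" using assms by unfold_locales
  interpret f: hecke_eigen N k f by fact
  show "subgroup (Hset N k f) (units_mod N)" by (rule f.subgroup_Hset)
  show "group.ord (units_mod N Mod Hset N k f) x \<in> {1, 2}"
    if "x \<in> carrier (units_mod N Mod Hset N k f)" for x
    using comm_group_units_mod[OF assms(1)] f.subgroup_Hset f.carrier_square_in_Hset that
    by (rule ord_quotient_of_squares)
  fix g
  show "Hset N k g = Hset N k f"
    if "hecke_eigenvector N k g \<and> g (neg_mod N 1) = f (neg_mod N 1)"
  proof -
    have g: "hecke_eigen N k g" using assms(1) that by (simp add: hecke_eigen_def)
    have eq: "g (neg_mod N 1) = f (neg_mod N 1)" using that ..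
    show ?thesis
      using Hset_same_base[OF f g eq] Hset_same_base[OF g f eq[symmetric]] by blast
  qed
  assume "hecke_eigenvector N k g"
  then have g: "hecke_eigen N k g" using assms(1) by unfold_locales
  show "g (neg_mod N 1) = f (neg_mod N 1) \<longleftrightarrow>
        (\<exists>\<psi> \<in> hom ((units_mod N)\<lparr>carrier := Hset N k f\<rparr>) complex_units.
           \<forall>e \<in> Hset N k f.
             g (neg_mod N e) = Sbar_scale N k (neg_mod N e) (\<psi> e) (f (neg_mod N e)))"
  proof
    assume "g (neg_mod N 1) = f (neg_mod N 1)"
    then show "\<exists>\<psi> \<in> hom ((units_mod N)\<lparr>carrier := Hset N k f\<rparr>) complex_units.
           \<forall>e \<in> Hset N k f.
             g (neg_mod N e) = Sbar_scale N k (neg_mod N e) (\<psi> e) (f (neg_mod N e))"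
      by (rule character_of_same_base[OF f g])
  next
    assume "\<exists>\<psi> \<in> hom ((units_mod N)\<lparr>carrier := Hset N k f\<rparr>) complex_units.
           \<forall>e \<in> Hset N k f.
             g (neg_mod N e) = Sbar_scale N k (neg_mod N e) (\<psi> e) (f (neg_mod N e))"
    then obtain \<psi> where hom: "\<psi> \<in> hom ((units_mod N)\<lparr>carrier := Hset N k f\<rparr>) complex_units"
      and \<psi>: "\<And>e. e \<in> Hset N k f \<Longrightarrow>
             g (neg_mod N e) = Sbar_scale N k (neg_mod N e) (\<psi> e) (f (neg_mod N e))" by blast
    have one: "1 mod int N \<in> Hset N k f" using f.Hset_one by simp
    \<comment> \<open>A nonzero idempotent complex number is 1, so the character relation at the
      unit element is the equality of the components at -1.\<close>
    have "\<psi> (1 mod int N) \<noteq> 0" "\<psi> (1 mod int N) = \<psi> (1 mod int N) * \<psi> (1 mod int N)"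
      using hom one by (auto simp: hom_def complex_units_def Pi_iff mod_simps dest!: bspec[OF _
          one])
    then have "\<psi> (1 mod int N) = 1" by simp
    then show "g (neg_mod N 1) = f (neg_mod N 1)"
      using \<psi>[OF one] by (simp add: neg_mod_mod Sbar_scale_1[OF assms(1) f.component_in_Sbar[OF
          f.e0]])
  qed
qed

end
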